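(* Let $c^{\mathrm{in}}=(c^{\mathrm{in}}_i)_{i\ge 0}\in X_{0,1}^+$. Assume that there are constants $C\ge 1$, $\mathcal{Q}\ge 1$ and non-negative numbers $q_{i,k}$ ($1\le k\le i$) such that $$\sum_{k=1}^i k(i-k+1)q_{i,k}\le \mathcal{Q}\,i\quad\text{for all } i\in\mathbb{N}_+,$$ and $$a(i,j;k)\le C(i-k+1)(j+k)q_{i,k}\quad\text{for all integers } 1\le k\le i \text{ and all } j\in\mathbb{N}_+ .$$ Then the initial value problem for the DGED system in the non-isolated case with initial condition $c(0)=c^{\mathrm{in}}$ has at least one global (mild) solution $c$ defined on $[0,\infty)$.
   Context: Notation: $\mathbb{N}=\{0,1,2,\dots\}$, $\mathbb{N}_+=\mathbb{N}\setminus\{0\}$. Rate coefficients: real numbers $a(p,q;k)\ge 0$ are given for all integers $p\ge1$, $q\ge 0$, $1\le k\le p$. Standing assumptions: $a(p,0;p)=0$ for all $p\in\mathbb{N}_+$; $a(k,j;k)=a(j,k;j)$ for all $j,k\in\mathbb{N}_+$; $a(i,0;k)=a(i,0;i-k)$ for all $i\in\mathbb{N}_+$, $1\le k\le i-1$. Discrete generalized exchange-driven (DGED) system, non-isolated case: $\dot c_i=\sum_{j=1}^4 Q_{j,i}(c)$, $i\in\mathbb{N}$, where for $i\in\mathbb{N}_+$ $$Q_{1,i}(c)=\sum_{k=1}^\infty\sum_{j=0}^\infty a(i+k,j;k)c_{i+k}c_j,\qquad Q_{2,i}(c)=-\sum_{k=1}^\infty\sum_{j=k}^\infty a(j,i;k)c_jc_i,$$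 $$Q_{3,i}(c)=\sum_{k=1}^i\sum_{j=k}^\infty a(j,i-k;k)c_jc_{i-k},\qquad Q_{4,i}(c)=-\sum_{k=1}^i\sum_{j=0}^\infty a(i,j;k)c_jc_i,$$ and $Q_{j,0}=0$ for $j=1,2,3,4$ (so $\dot c_0=0$ and $c_0$ is constant in time). Spaces: $X_{0,1}=\{c:\mathbb{N}\to\mathbb{R} : \|c\|:=\sum_{i=0}^\infty(1+i)|c_i|<\infty\}$, $X_{0,1}^+=\{c\in X_{0,1}: c_i\ge 0\ \forall i\}$. Mild solution: for $T\in(0,+\infty]$, a (mild) solution on $[0,T)$ with initial condition $c^{\mathrm{in}}\in X_{0,1}^+$ is a sequence of nonnegative functions $c=(c_i):[0,T)\to X_{0,1}^+$ such that for each $i\in\mathbb{N}$ and $t\in(0,T)$: (i) $c_i\in C^0([0,T))$; (ii) $Q_{j,i}(c(\cdot))\in L^1(0,t)$ for $j=1,2,3,4$; (iii) $c_i(t)=c^{\mathrm{in}}_i+\int_0^t\sum_{j=1}^4Q_{j,i}(c(s))\,ds$. *)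

theory Defs
  imports "HOL-Analysis.Analysis"
begin

text \<open>
  A rate coefficient \<open>a(p,q;k)\<close> is written \<open>a p q k\<close>. Only the values with
  \<open>1 \<le> k \<le> p\<close> are meaningful; nothing is assumed about the others, and they never
  occur in the system below.
\<close>

definition rate_coefficients :: "(nat \<Rightarrow> nat \<Rightarrow> nat \<Rightarrow> real) \<Rightarrow> bool" where
  "rate_coefficients a \<longleftrightarrow>
     (\<forall>p q k. 1 \<le> k \<and> k \<le> p \<longrightarrow> 0 \<le> a p q k) \<and>
     (\<forall>p\<ge>1. a p 0 p = 0) \<and>
     (\<forall>j\<ge>1. \<forall>k\<ge>1. a k j k = a j k j) \<and>
     (\<forall>i\<ge>1. \<forall>k. 1 \<le> k \<and> k \<le> i - 1 \<longrightarrow> a i 0 k = a i 0 (i - k))"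

definition X01 :: "(nat \<Rightarrow> real) set" where
  "X01 = {c. summable (\<lambda>i. (1 + real i) * \<bar>c i\<bar>)}"

definition X01_pos :: "(nat \<Rightarrow> real) set" where
  "X01_pos = {c \<in> X01. \<forall>i. 0 \<le> c i}"

text \<open>
  The terms of all four series \<open>Q\<^sub>1, \<dots>, Q\<^sub>4\<close> have the form \<open>a(p,q;k) c\<^sub>p c\<^sub>q\<close>.
\<close>

definition exch :: "(nat \<Rightarrow> nat \<Rightarrow> nat \<Rightarrow> real) \<Rightarrow> (nat \<Rightarrow> real) \<Rightarrow> nat \<Rightarrow> nat \<Rightarrow> nat \<Rightarrow> real" where
  "exch a c p q k = a p q k * c p * c q"

definition Q1 :: "(nat \<Rightarrow> nat \<Rightarrow> nat \<Rightarrow> real) \<Rightarrow> nat \<Rightarrow> (nat \<Rightarrow> real) \<Rightarrow> real" where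
  "Q1 a i c = (if i = 0 then 0 else \<Sum>\<^sub>\<infinity>k\<in>{1..}. \<Sum>\<^sub>\<infinity>j\<in>{0..}. exch a c (i + k) j k)"

definition Q2 :: "(nat \<Rightarrow> nat \<Rightarrow> nat \<Rightarrow> real) \<Rightarrow> nat \<Rightarrow> (nat \<Rightarrow> real) \<Rightarrow> real" where
  "Q2 a i c = (if i = 0 then 0 else - (\<Sum>\<^sub>\<infinity>k\<in>{1..}. \<Sum>\<^sub>\<infinity>j\<in>{k..}. exch a c j i k))"

definition Q3 :: "(nat \<Rightarrow> nat \<Rightarrow> nat \<Rightarrow> real) \<Rightarrow> nat \<Rightarrow> (nat \<Rightarrow> real) \<Rightarrow> real" where
  "Q3 a i c = (if i = 0 then 0 else \<Sum>k = 1..i. \<Sum>\<^sub>\<infinity>j\<in>{k..}. exch a c j (i - k) k)"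

definition Q4 :: "(nat \<Rightarrow> nat \<Rightarrow> nat \<Rightarrow> real) \<Rightarrow> nat \<Rightarrow> (nat \<Rightarrow> real) \<Rightarrow> real" where
  "Q4 a i c = (if i = 0 then 0 else - (\<Sum>k = 1..i. \<Sum>\<^sub>\<infinity>j\<in>{0..}. exch a c i j k))"

text \<open>
  \<open>infsum\<close> is \<open>0\<close> on a divergent series, so the convergence of the (iterated) series that
  define \<open>Q\<^sub>1, \<dots>, Q\<^sub>4\<close> has to be stated separately.
\<close>

definition Q_convergent :: "(nat \<Rightarrow> nat \<Rightarrow> nat \<Rightarrow> real) \<Rightarrow> nat \<Rightarrow> (nat \<Rightarrow> real) \<Rightarrow> bool" where
  "Q_convergent a i c \<longleftrightarrow> i = 0 \<or>
     ((\<forall>k\<in>{1..}. (\<lambda>j. exch a c (i + k) j k) summable_on {0..}) \<and>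
      (\<lambda>k. \<Sum>\<^sub>\<infinity>j\<in>{0..}. exch a c (i + k) j k) summable_on {1..} \<and>
      (\<forall>k\<in>{1..}. (\<lambda>j. exch a c j i k) summable_on {k..}) \<and>
      (\<lambda>k. \<Sum>\<^sub>\<infinity>j\<in>{k..}. exch a c j i k) summable_on {1..} \<and>
      (\<forall>k\<in>{1..i}. (\<lambda>j. exch a c j (i - k) k) summable_on {k..}) \<and>
      (\<forall>k\<in>{1..i}. (\<lambda>j. exch a c i j k) summable_on {0..}))"

text \<open>
  \<open>c t i\<close> is the component \<open>c\<^sub>i(t)\<close>; values of \<open>c\<close> outside \<open>[0,T)\<close> are irrelevant.
  The condition \<open>Q\<^bsub>j,i\<^esub>(c(\<cdot>)) \<in> L\<^sup>1(0,t)\<close> means that the series converge for almost every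
  time and that the resulting function is Lebesgue integrable on \<open>(0,t)\<close>. Convergence at
  every time must not be demanded: no growth bound is imposed on \<open>a(p,0;k)\<close>, so a series
  may diverge at exceptional times such as \<open>0\<close>.
\<close>

definition mild_solution ::
  "(nat \<Rightarrow> nat \<Rightarrow> nat \<Rightarrow> real) \<Rightarrow> ereal \<Rightarrow> (nat \<Rightarrow> real) \<Rightarrow> (real \<Rightarrow> nat \<Rightarrow> real) \<Rightarrow> bool" where
  "mild_solution a T cin c \<longleftrightarrow>
     (\<forall>t. 0 \<le> t \<and> ereal t < T \<longrightarrow> c t \<in> X01_pos) \<and>
     (\<forall>i. continuous_on {t. 0 \<le> t \<and> ereal t < T} (\<lambda>t. c t i)) \<and>
     (\<forall>i t. 0 < t \<and> ereal t < T \<longrightarrow>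
        (AE s\<in>{0<..<t} in lebesgue. Q_convergent a i (c s)) \<and>
        (\<forall>Q\<in>{Q1, Q2, Q3, Q4}. set_integrable lebesgue {0<..<t} (\<lambda>s. Q a i (c s))) \<and>
        c t i = cin i +
          (LINT s:{0<..<t}|lebesgue.
             Q1 a i (c s) + Q2 a i (c s) + Q3 a i (c s) + Q4 a i (c s)))"

end

theory Submission
  imports Defs "HOL-Complex_Analysis.Great_Picard"
begin

text \<open>
  Each triple \<open>(p, q, k)\<close> with \<open>1 \<le> k \<le> p\<close> is a reaction that moves \<open>k\<close> units from a cluster of
  size \<open>p\<close> to a cluster of size \<open>q\<close>; the case \<open>q = 0\<close> is fragmentation, whose coefficients
  are not bounded at all. The system with finitely many reactions is solved approximately by the
  explicit Euler scheme, with steps so small that the components stay nonnegative and the mass is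
  conserved exactly.

  By de la Vallee Poussin there is a slowly growing \<open>d\<close> that tends to infinity, such that
  the convex weight \<open>g i = d 0 + \<dots> + d (i - 1)\<close> still has a finite moment for the initial datum.
  The growth condition bounds the increase of this moment caused by exchange with \<open>q \<ge> 1\<close>, while
  a fragmentation decreases it by \<open>g p - g k - g (p - k) \<ge> d (p - 1) - d 0\<close>. The resulting
  dissipation bounds the time integral of all reaction rates, weighted by a quantity
  that tends to infinity, uniformly in the truncation. This tightness yields equicontinuity of the
  approximations, hence a convergent subsequence, and it passes the time-integrated equation to
  the limit. It also shows that the sum of all reaction rates of the limit is integrable in time, so
  \<open>Q\<^sub>1, \<dots>, Q\<^sub>4\<close> converge for almost every time and are integrable as subseries.
\<close>

subsection \<open>A slowly growing convex weight\<close>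

text \<open>Choose thresholds \<open>N m\<close> beyond which the tail of \<open>x\<close> is at
  most \<open>(1/2)^m\<close>, and let \<open>d l\<close> be one plus the number of thresholds up to
  \<open>l\<close>. Each threshold adds one tail to the sum of \<open>d i * x i\<close>, hence all
  together add at most 2; sparse thresholds give the doubling bound.\<close>

lemma ex_slow_weight:
  fixes x :: "nat \<Rightarrow> real"
  assumes nonneg: "\<And>i. 0 \<le> x i" and x: "summable x"
  obtains d :: "nat \<Rightarrow> real" where "mono d" "\<And>l. 1 \<le> d l" "\<And>l. d (2 * l + 1) \<le> 2 * d l"
    "filterlim d at_top sequentially" "summable (\<lambda>i. d i * x i)"
proof -
  have "\<exists>n0. \<forall>n. sum x {n0..<n} \<le> (1/2)^m" for m :: nat
  proof -
    have "(1/2::real)^m > 0" by simp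
    then obtain n0 where "\<forall>p\<ge>n0. \<forall>n. norm (sum x {p..<n}) < (1/2)^m"
      using x unfolding summable_Cauchy by meson
    then show ?thesis by (intro exI[of _ n0]) (smt (verit) real_norm_def order_refl)
  qed
  then obtain T where T: "\<And>m n. sum x {T m..<n} \<le> (1/2)^m" by metis
  \<comment> \<open>The bound \<open>2 * r + 2\<close> leaves room for at most one threshold between
    \<open>l + 1\<close> and \<open>2 * l + 1\<close>, so \<open>d\<close> grows there by at most
    one, and \<open>d l\<close> is itself at least one.\<close>
  define N where "N = rec_nat (T 0) (\<lambda>m r. max (T (Suc m)) (2 * r + 2))"
  have N_Suc: "N (Suc m) = max (T (Suc m)) (2 * N m + 2)" for m by (simp add: N_def)
  have N_step: "2 * N m + 2 \<le> N (Suc m)" for m by (simp add: N_Suc)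
  have N_T: "T m \<le> N m" for m by (cases m) (simp_all add: N_Suc, simp add: N_def)
  have N_mono: "strict_mono N"
  proof (rule strict_monoI_Suc)
    show "N m < N (Suc m)" for m using N_step[of m] by linarith
  qed
  have N_ge: "m \<le> N m" for m using strict_mono_imp_increasing[OF N_mono] .
  have N_tail: "sum x {N m..<n} \<le> (1/2)^m" for m n
  proof -
    have "sum x {N m..<n} \<le> sum x {T m..<n}"
      using N_T[of m] nonneg by (intro sum_mono2) auto
    then show ?thesis using T[of m n] by linarith
  qed
  define A where "A l = {m. N m \<le> l}" for l
  have A_sub: "A l \<subseteq> {..l}" for l using N_ge unfolding A_def by (auto intro: order_trans)
  have A_fin: "finite (A l)" for l using A_sub finite_subset by blast
  define d where "d l = 1 + real (card (A l))" for l
  have d_mono: "mono d"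
    unfolding d_def by (intro monoI) (auto intro!: card_mono[OF A_fin[unfolded A_def]] simp: A_def)
  have d_double: "d (2 * l + 1) \<le> 2 * d l" for l
  proof -
    have "m = m'" if "m \<in> A (2*l+1) - A l" "m' \<in> A (2*l+1) - A l" for m m'
    proof -
      have *: False if "m < m'" "l < N m" "N m' \<le> 2*l+1" for m m'
      proof -
        have "N (Suc m) \<le> N m'" using that(1) N_mono by (simp add: strict_mono_less_eq)
        then show False using N_step[of m] that by linarith
      qed
      have "\<not> m < m'" "\<not> m' < m" using *[of m m'] *[of m' m] that by (auto simp: A_def)
      then show ?thesis by simp
    qed
    then have "card (A (2*l+1) - A l) \<le> Suc 0"
      by (subst card_le_Suc0_iff_eq) (auto simp: A_fin)
    moreover have "card (A (2*l+1)) \<le> card (A l) + card (A (2*l+1) - A l)"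
      by (rule order_trans[OF card_mono card_Un_le]) (auto simp: A_fin)
    ultimately have "card (A (2*l+1)) \<le> card (A l) + 1" by linarith
    then have "real (card (A (2*l+1))) \<le> real (card (A l) + 1)" by (rule of_nat_mono)
    then show ?thesis unfolding d_def by simp
  qed
  have d_lim: "filterlim d at_top sequentially"
  proof (subst filterlim_at_top, intro allI)
    fix Z :: real
    have "Z \<le> d l" if "N (nat \<lceil>Z\<rceil>) \<le> l" for l
    proof -
      have "{..nat \<lceil>Z\<rceil>} \<subseteq> A l"
        using that N_mono unfolding A_def by (auto simp: strict_mono_less_eq intro: order_trans[rotated])
      from card_mono[OF A_fin this] show ?thesis unfolding d_def
        using real_nat_ceiling_ge[of Z] by auto
    qed
    then show "\<forall>\<^sub>F l in sequentially. Z \<le> d l" unfolding eventually_sequentially by blast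
  qed
  have "summable (\<lambda>i. d i * x i)"
  proof (rule summableI_nonneg_bounded)
    show "0 \<le> d i * x i" for i by (simp add: d_def nonneg)
    show "(\<Sum>i<I. d i * x i) \<le> suminf x + 2" for I
    proof -
      have "(\<Sum>i<I. d i * x i) = (\<Sum>i<I. x i) + (\<Sum>i<I. \<Sum>m\<in>A i. x i)"
        by (simp add: d_def distrib_right sum.distrib)
      \<comment> \<open>As \<open>m \<le> N m\<close>, only thresholds with \<open>m < I\<close> can
        lie at or below an index \<open>i < I\<close>; this makes the double sum rectangular and
        lets it be summed over \<open>i\<close> first.\<close>
      also have "(\<Sum>i<I. \<Sum>m\<in>A i. x i) = (\<Sum>i<I. \<Sum>m | m \<in> {..<I} \<and> N m \<le> i. x i)"
        using A_sub by (intro sum.cong refl) (fastforce simp: A_def)+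
      also have "\<dots> = (\<Sum>m<I. \<Sum>i | i \<in> {..<I} \<and> N m \<le> i. x i)"
        by (rule sum.swap_restrict) auto
      also have "\<dots> = (\<Sum>m<I. sum x {N m..<I})"
        by (intro sum.cong refl) auto
      also have "\<dots> \<le> (\<Sum>m<I. (1/2)^m)" by (intro sum_mono N_tail)
      also have "\<dots> \<le> (\<Sum>m. (1/2::real)^m)" by (intro sum_le_suminf) auto
      also have "\<dots> = 2" by (simp add: suminf_geometric)
      finally show ?thesis using sum_le_suminf[OF x, of "{..<I}"] nonneg by auto
    qed
  qed
  with d_mono d_double d_lim show ?thesis by (intro that[of d]) (auto simp: d_def)
qed

section \<open>Inequalities for the convex weight\<close>

locale slow_weight =
  fixes d :: "nat \<Rightarrow> real"
  assumes d_mono: "mono d" and d_ge: "\<And>l. 1 \<le> d l" and d_double: "\<And>l. d (2 * l + 1) \<le> 2 * d l"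
begin

definition g :: "nat \<Rightarrow> real" where "g i = (\<Sum>l<i. d l)"

lemma g_0 [simp]: "g 0 = 0" by (simp add: g_def)

lemma d_nonneg: "0 \<le> d l" using d_ge[of l] by linarith

lemma d_le: "l \<le> m \<Longrightarrow> d l \<le> d m" using d_mono by (rule monoD)

lemma g_nonneg: "0 \<le> g i" unfolding g_def by (intro sum_nonneg d_nonneg)

lemma g_add: "g (i + k) = g i + (\<Sum>l<k. d (i + l))"
  by (induction k) (simp_all add: g_def)

lemma g_le: "g i \<le> real i * d i"
  unfolding g_def using sum_bounded_above[of "{..<i}" d "d i"] d_le by auto

lemma g_shift: "i \<le> j \<Longrightarrow> g (i + k) - g i \<le> g (j + k) - g j"
  unfolding g_add by (auto intro!: sum_mono d_le)

lemma g_superadd: "g i + g k \<le> g (i + k)"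
  using g_shift[of 0 i k] by simp

lemma g_add_le: "g (i + k) - g i \<le> real k * d (i + k)"
  unfolding g_add using sum_bounded_above[of "{..<k}" "\<lambda>l. d (i + l)" "d (i + k)"] d_le by auto

lemma g_add_ge: "real k * d i \<le> g (i + k) - g i"
  unfolding g_add using sum_bounded_below[of "{..<k}" "d i" "\<lambda>l. d (i + l)"] d_le by auto

text \<open>Convexity and \<open>g 0 = 0\<close> make \<open>g k / k\<close> nondecreasing: the
  first \<open>k\<close> increments are at most \<open>d k\<close>, the remaining ones at least
  \<open>d k\<close>.\<close>

lemma g_star:
  assumes "k \<le> p" shows "real p * g k \<le> real k * g p"
proof -
  obtain m where p: "p = k + m" using assms le_Suc_ex by blast
  have "real m * g k \<le> real m * (real k * d k)" by (intro mult_left_mono g_le) simp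
  also have "\<dots> = real k * (real m * d k)" by simp
  also have "\<dots> \<le> real k * (g (k + m) - g k)" by (intro mult_left_mono g_add_ge) simp
  finally show ?thesis by (simp add: p algebra_simps)
qed

text \<open>The upper half of the increments consists of at least \<open>p / 2\<close> terms, and by
  the doubling bound each of them is at least \<open>d p / 2\<close>.\<close>

lemma d_le_g: "real p * d p \<le> 4 * g p"
proof -
  obtain m where m: "p = p div 2 + m" by (metis div_le_dividend le_Suc_ex)
  have "d p \<le> d (2 * (p div 2) + 1)" by (intro d_le) linarith
  then have "d p \<le> 2 * d (p div 2)" using d_double order_trans by blast
  moreover have "real p \<le> 2 * real m" using m by linarith
  ultimately have "real p * d p \<le> (2 * real m) * (2 * d (p div 2))"
    by (intro mult_mono d_nonneg) auto
  also have "\<dots> = 4 * (real m * d (p div 2))" by simp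
  also have "\<dots> \<le> 4 * (g (p div 2 + m) - g (p div 2))" using g_add_ge by (intro mult_left_mono) auto
  also have "\<dots> \<le> 4 * g p" using g_nonneg m by simp
  finally show ?thesis .
qed

text \<open>By symmetry let \<open>k \<le> q\<close>. Then \<open>q + k \<le> 2 * q\<close>, the
  increments involved are at most \<open>2 * d q\<close>, and \<open>d_le_g\<close> turns
  \<open>real q * d q\<close> back into \<open>g q\<close>. The prefactor \<open>q + k\<close> is
  the one that the growth condition allows in the rates.\<close>

lemma g_merge:
  "real (q + k) * (g (q + k) - g q - g k) \<le> 16 * (real q * g k + real k * g q)"
proof -
  have *: "real (q + k) * (g (q + k) - g q - g k) \<le> 16 * (real q * g k + real k * g q)" if "k \<le> q" for q k
  proof -
    have "d (q + k) \<le> 2 * d q" using that d_le[of "q + k" "2*q+1"] d_double[of q] by linarith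
    then have "real k * d (q + k) \<le> real k * (2 * d q)" by (intro mult_left_mono) auto
    then have 1: "g (q + k) - g q - g k \<le> 2 * real k * d q" using g_add_le[of q k] g_nonneg[of k] by linarith
    have "real (q + k) * (g (q + k) - g q - g k) \<le> real (q + k) * (2 * real k * d q)"
      by (intro mult_left_mono 1) simp
    also have "\<dots> \<le> (2 * real q) * (2 * real k * d q)"
      using that by (intro mult_right_mono) (auto simp: d_nonneg)
    also have "\<dots> = 4 * real k * (real q * d q)" by simp
    also have "\<dots> \<le> 4 * real k * (4 * g q)" by (intro mult_left_mono d_le_g) simp
    also have "\<dots> \<le> 16 * (real q * g k + real k * g q)" using g_nonneg[of k] by simp
    finally show ?thesis .
  qed
  show ?thesis using *[of k q] *[of q k] by (cases "k \<le> q") (simp_all add: algebra_simps)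
qed

text \<open>The increments of \<open>g k\<close> after the first are at most those leading from
  \<open>p - k\<close> to \<open>p - 1\<close>. What remains is the last increment
  \<open>d (p - 1)\<close> against the first one, \<open>d 0\<close>.\<close>

lemma g_split:
  assumes "1 \<le> k" "k < p" shows "d (p - 1) - d 0 \<le> g p - g k - g (p - k)"
proof -
  have "g (1 + (k - 1)) - g 1 \<le> g ((p - k) + (k - 1)) - g (p - k)"
    using assms by (intro g_shift) linarith
  then have "g k - g 1 \<le> g (p - 1) - g (p - k)" using assms by simp
  moreover have "g 1 = d 0" by (simp add: g_def)
  moreover have "g p = g (p - 1) + d (p - 1)" using assms by (cases p) (simp_all add: g_def)
  ultimately show ?thesis by linarith
qed

end

subsection \<open>Moment bounds for the truncated Euler scheme\<close>

definition reactions :: "(nat \<times> nat \<times> nat) set" where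
  "reactions = {(p, q, k). 1 \<le> k \<and> k \<le> p}"

definition reactions_upto :: "nat \<Rightarrow> (nat \<times> nat \<times> nat) set" where
  "reactions_upto n = {(p, q, k). p \<le> n \<and> q \<le> n \<and> 1 \<le> k \<and> k \<le> p}"

text \<open>
  The net gain of clusters of size \<open>i\<close> in one reaction; size \<open>0\<close> is excluded because \<open>c\<^sub>0\<close>
  is kept constant.
\<close>

fun stoich :: "nat \<Rightarrow> nat \<times> nat \<times> nat \<Rightarrow> real" where
  "stoich i (p, q, k) = (if i = 0 then 0 else
     of_bool (i = p - k) + of_bool (i = q + k) - of_bool (i = p) - of_bool (i = q))"

text \<open>The change of the total of \<open>w\<close> in one reaction. Unlike in
  \<open>stoich\<close>, size 0 is not excepted, which makes no difference when
  \<open>w 0 = 0\<close>.\<close>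

fun gain :: "(nat \<Rightarrow> real) \<Rightarrow> nat \<times> nat \<times> nat \<Rightarrow> real" where
  "gain w (p, q, k) = w (p - k) + w (q + k) - w p - w q"

lemma reactions_upto_Sigma: "reactions_upto n = (SIGMA p:{..n}. {..n} \<times> {1..p})"
  by (auto simp: reactions_upto_def)

lemma finite_reactions_upto [simp]: "finite (reactions_upto n)"
  by (simp add: reactions_upto_Sigma)

lemma reactions_upto_subset: "reactions_upto n \<subseteq> reactions"
  by (auto simp: reactions_upto_def reactions_def)

lemma sum_reactions_upto: "(\<Sum>r\<in>reactions_upto n. f r) = (\<Sum>p\<le>n. \<Sum>q\<le>n. \<Sum>k=1..p. f (p, q, k))"
  unfolding reactions_upto_Sigma by (simp add: sum.Sigma sum.cartesian_product case_prod_unfold)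

lemma abs_stoich_le: "\<bar>stoich i r\<bar> \<le> 4"
  by (cases r) auto

text \<open>Sizes up to \<open>n\<close> only produce sizes up to \<open>2 * n\<close>, so this
  range misses no participant of the reaction.\<close>

lemma sum_stoich:
  assumes "r \<in> reactions_upto n" "w 0 = 0"
  shows "(\<Sum>i\<le>2*n. w i * stoich i r) = gain w r"
proof -
  obtain p q k where r: "r = (p, q, k)" by (cases r)
  have *: "(\<Sum>i\<le>2*n. w i * of_bool (i = j)) = w j" if "j \<le> 2*n" for j
    using sum.delta[of "{..2*n}" j w] that by (simp add: of_bool_def if_distrib cong: if_cong)
  have "(\<Sum>i\<le>2*n. w i * stoich i r) = (\<Sum>i\<le>2*n. w i * of_bool (i = p - k) +
     w i * of_bool (i = q + k) - w i * of_bool (i = p) - w i * of_bool (i = q))"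
    using assms(2) by (intro sum.cong refl) (auto simp: r algebra_simps)
  also have "\<dots> = gain w r"
    using assms(1) by (simp only: sum.distrib sum_subtractf r) (subst *; auto simp: reactions_upto_def)+
  finally show ?thesis .
qed

section \<open>Positivity and mass for the Euler scheme\<close>

locale exchange =
  fixes a :: "nat \<Rightarrow> nat \<Rightarrow> nat \<Rightarrow> real" and q :: "nat \<Rightarrow> nat \<Rightarrow> real"
    and C QQ :: real and cin :: "nat \<Rightarrow> real"
  assumes rate: "rate_coefficients a"
    and cin: "cin \<in> X01_pos"
    and C_ge: "C \<ge> 1" and QQ_ge: "QQ \<ge> 1"
    and q_nonneg: "\<And>i k. 1 \<le> k \<Longrightarrow> k \<le> i \<Longrightarrow> q i k \<ge> 0"
    and q_sum: "\<And>i. i \<ge> 1 \<Longrightarrow> (\<Sum>k = 1..i. real k * real (i - k + 1) * q i k) \<le> QQ * real i"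
    and a_le: "\<And>i j k. 1 \<le> k \<Longrightarrow> k \<le> i \<Longrightarrow> j \<ge> 1 \<Longrightarrow>
           a i j k \<le> C * real (i - k + 1) * real (j + k) * q i k"
begin

fun coeff :: "nat \<times> nat \<times> nat \<Rightarrow> real" where "coeff (p, j, k) = a p j k"

fun flux :: "(nat \<Rightarrow> real) \<Rightarrow> nat \<times> nat \<times> nat \<Rightarrow> real" where
  "flux c (p, j, k) = exch a c p j k"

primrec euler :: "nat \<Rightarrow> real \<Rightarrow> nat \<Rightarrow> nat \<Rightarrow> real" where
  "euler n h 0 = cin"
| "euler n h (Suc m) =
     (\<lambda>i. euler n h m i + h * (\<Sum>r\<in>reactions_upto n. stoich i r * flux (euler n h m) r))"

definition mass :: real where "mass = (\<Sum>i. real i * cin i)"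
text \<open>A common bound for all components: size 0 stays at \<open>cin 0\<close>, and a component
  of positive size is at most the mass it carries.\<close>

definition bound :: real where "bound = mass + cin 0"

lemma a_nonneg: "1 \<le> k \<Longrightarrow> k \<le> p \<Longrightarrow> 0 \<le> a p j k"
  using rate unfolding rate_coefficients_def by blast

lemma a_0: "1 \<le> p \<Longrightarrow> a p 0 p = 0"
  using rate unfolding rate_coefficients_def by blast

lemma coeff_nonneg: "r \<in> reactions \<Longrightarrow> 0 \<le> coeff r"
  by (auto simp: reactions_def a_nonneg)

lemma flux_nonneg: "r \<in> reactions \<Longrightarrow> (\<And>i. 0 \<le> c i) \<Longrightarrow> 0 \<le> flux c r"
  by (auto simp: reactions_def exch_def a_nonneg)

lemma cin_nonneg: "0 \<le> cin i" using cin by (simp add: X01_pos_def)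

lemma summable_mass: "summable (\<lambda>i. real i * cin i)"
proof (rule summable_comparison_test')
  show "summable (\<lambda>i. (1 + real i) * \<bar>cin i\<bar>)" using cin unfolding X01_pos_def X01_def by blast
  show "norm (real i * cin i) \<le> (1 + real i) * \<bar>cin i\<bar>" if "0 \<le> i" for i
    by (simp add: abs_mult mult_right_mono)
qed

lemma sum_cin_le_mass: "finite I \<Longrightarrow> (\<Sum>i\<in>I. real i * cin i) \<le> mass"
  unfolding mass_def by (rule sum_le_suminf[OF summable_mass]) (auto simp: cin_nonneg)

lemma mass_nonneg: "0 \<le> mass" using sum_cin_le_mass[of "{}"] by simp

lemma le_bound:
  assumes "\<And>i. 0 \<le> u i" "u 0 = cin 0" "finite I" "(\<Sum>i\<in>I. real i * u i) \<le> mass" "i \<in> I"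
  shows "u i \<le> bound"
proof (cases "i = 0")
  case True then show ?thesis using assms mass_nonneg by (simp add: bound_def)
next
  case False
  then have "u i \<le> real i * u i" using assms(1)[of i] by (simp add: mult_le_cancel_right1)
  also have "\<dots> \<le> (\<Sum>i\<in>I. real i * u i)" using assms by (intro member_le_sum) auto
  finally show ?thesis using assms(4) cin_nonneg[of 0] by (simp add: bound_def)
qed

lemma cin_le_bound: "cin i \<le> bound"
  by (rule le_bound[of cin "{i}"]) (use cin_nonneg sum_cin_le_mass[of "{i}"] in auto)

lemma bound_nonneg: "0 \<le> bound" using cin_le_bound[of 0] cin_nonneg[of 0] by linarith

lemma flux_le:
  assumes "r \<in> reactions" "\<And>i. 0 \<le> c i" "\<And>i. c i \<le> bound"
  shows "flux c r \<le> coeff r * bound\<^sup>2"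
  using assms
  by (cases r) (auto simp: exch_def power2_eq_square mult.assoc reactions_def a_nonneg bound_nonneg intro!: mult_left_mono mult_mono)

text \<open>The discrete weak form: interchanging the sums over sizes and reactions leaves the gain
  of each reaction.\<close>

lemma euler_weak:
  assumes "w 0 = 0"
  shows "(\<Sum>i\<le>2*n. w i * euler n h (Suc m) i) = (\<Sum>i\<le>2*n. w i * euler n h m i) +
     h * (\<Sum>r\<in>reactions_upto n. flux (euler n h m) r * gain w r)"
proof -
  have "(\<Sum>i\<le>2*n. w i * (h * (\<Sum>r\<in>reactions_upto n. stoich i r * flux (euler n h m) r))) =
     h * (\<Sum>i\<le>2*n. \<Sum>r\<in>reactions_upto n. flux (euler n h m) r * (w i * stoich i r))"
    by (simp add: sum_distrib_left sum_distrib_right mult_ac)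
  also have "\<dots> = h * (\<Sum>r\<in>reactions_upto n. flux (euler n h m) r * (\<Sum>i\<le>2*n. w i * stoich i r))"
    by (subst sum.swap) (simp add: sum_distrib_left)
  also have "\<dots> = h * (\<Sum>r\<in>reactions_upto n. flux (euler n h m) r * gain w r)"
    using assms by (simp add: sum_stoich)
  finally show ?thesis by (simp add: distrib_left sum.distrib)
qed

text \<open>Every loss of \<open>u i\<close> is proportional to \<open>u i\<close> itself, with a
  factor controlled by the other component; for the small steps assumed here, one step cannot remove
  more than \<open>u i\<close>. Sizes beyond \<open>2 * n\<close> take part in no reaction, and each
  reaction conserves mass.\<close>

lemma euler_invariant:
  assumes h: "0 \<le> h" "2 * h * bound * (\<Sum>r\<in>reactions_upto n. coeff r) \<le> 1"
  shows "(\<forall>i. 0 \<le> euler n h m i) \<and> euler n h m 0 = cin 0 \<and> (\<forall>i>2*n. euler n h m i = cin i) \<and>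
    (\<Sum>i\<le>2*n. real i * euler n h m i) \<le> mass"
proof (induction m)
  case 0
  then show ?case using cin_nonneg sum_cin_le_mass by simp
next
  case (Suc m)
  define u where "u = euler n h m"
  have u: "\<And>i. 0 \<le> u i" "u 0 = cin 0" "\<And>i. i > 2*n \<Longrightarrow> u i = cin i"
    "(\<Sum>i\<le>2*n. real i * u i) \<le> mass"
    using Suc unfolding u_def by auto
  have le: "u i \<le> bound" if "i \<le> 2*n" for i
    by (rule le_bound[of u "{..2*n}"]) (use u that in auto)
  have step: "euler n h (Suc m) i = u i + h * (\<Sum>r\<in>reactions_upto n. stoich i r * flux u r)" for i
    by (simp add: u_def)
  have "0 \<le> euler n h (Suc m) i" for i
  proof -
    \<comment> \<open>The factor 2 covers the case in which donor and acceptor both have size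
      \<open>i\<close>.\<close>
    have *: "- (2 * bound * coeff r * u i) \<le> stoich i r * flux u r" if r: "r \<in> reactions_upto n" for r
    proof -
      obtain p j k where r': "r = (p, j, k)" by (cases r)
      have b: "0 \<le> a p j k" "u p \<le> bound" "u j \<le> bound"
        using r le by (auto simp: r' reactions_upto_def a_nonneg)
      have 1: "of_bool (i = p) * (u p * u j) \<le> bound * u i"
        using b u(1)[of p] u(1)[of i] bound_nonneg by (auto simp: mult.commute mult_right_mono)
      have 2: "of_bool (i = j) * (u p * u j) \<le> bound * u i"
        using b u(1)[of i] bound_nonneg by (auto simp: mult_right_mono)
      have pp: "0 \<le> u p * u j" using u(1) by simp
      have "- (of_bool (i = p) + of_bool (i = j)) * (u p * u j) \<le> stoich i r * (u p * u j)"
        using pp by (intro mult_right_mono) (auto simp: r')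
      then have "- (2 * bound * u i) \<le> stoich i r * (u p * u j)"
        using 1 2 unfolding minus_mult_left[symmetric] distrib_right by linarith
      then have "a p j k * (- (2 * bound * u i)) \<le> a p j k * (stoich i r * (u p * u j))"
        using b by (intro mult_left_mono)
      then show ?thesis by (simp add: r' exch_def mult_ac)
    qed
    have "- (2 * h * bound * (\<Sum>r\<in>reactions_upto n. coeff r)) * u i = h * (\<Sum>r\<in>reactions_upto n. - (2 * bound * coeff r * u i))"
      by (simp add: sum_distrib_left sum_distrib_right sum_negf mult_ac)
    also have "\<dots> \<le> h * (\<Sum>r\<in>reactions_upto n. stoich i r * flux u r)"
      by (intro mult_left_mono sum_mono * h)
    finally have "u i * (1 - 2 * h * bound * (\<Sum>r\<in>reactions_upto n. coeff r)) \<le> euler n h (Suc m) i"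
      unfolding step by (simp add: algebra_simps)
    moreover have "0 \<le> u i * (1 - 2 * h * bound * (\<Sum>r\<in>reactions_upto n. coeff r))"
      using u(1) h by (intro mult_nonneg_nonneg) auto
    ultimately show ?thesis by linarith
  qed
  moreover have "euler n h (Suc m) 0 = cin 0"
  proof -
    have "stoich 0 r = 0" for r by (cases r) simp
    then show ?thesis using u(2) by (simp add: step del: euler.simps)
  qed
  moreover have "euler n h (Suc m) i = cin i" if "i > 2*n" for i
  proof -
    have "stoich i r = 0" if "r \<in> reactions_upto n" for r using that \<open>i > 2*n\<close> by (auto simp: reactions_upto_def)
    then show ?thesis using u(3) that by (simp add: step del: euler.simps)
  qed
  moreover have "(\<Sum>i\<le>2*n. real i * euler n h (Suc m) i) \<le> mass"
  proof -
    have "gain real r = 0" if "r \<in> reactions_upto n" for r using that by (auto simp: reactions_upto_def)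
    then show ?thesis using euler_weak[of real n h m] u(4) by (simp add: u_def del: euler.simps)
  qed
  ultimately show ?case by blast
qed

lemma euler_le_bound:
  assumes "0 \<le> h" "2 * h * bound * (\<Sum>r\<in>reactions_upto n. coeff r) \<le> 1"
  shows "euler n h m i \<le> bound"
proof (cases "i \<le> 2*n")
  case True
  then show ?thesis using euler_invariant[OF assms, of m]
    by (intro le_bound[of _ "{..2*n}"]) auto
next
  case False
  then show ?thesis using euler_invariant[OF assms, of m] cin_le_bound by simp
qed

text \<open>With the sum over time taken inside, each reaction contributes its own time-integrated
  flux, and limits can be taken reaction by reaction.\<close>

lemma euler_eq:
  "euler n h m i = cin i + (\<Sum>r\<in>reactions_upto n. stoich i r * (h * (\<Sum>l<m. flux (euler n h l) r)))"
  by (induction m) (simp_all add: algebra_simps sum.distrib sum_distrib_left)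

end

section \<open>The weighted moment and its dissipation\<close>

locale weighted_exchange = exchange + slow_weight +
  assumes d_lim: "filterlim d at_top sequentially"
    and d_cin: "summable (\<lambda>i. d i * (real i * cin i))"
begin

text \<open>The first term is the dissipation from \<open>g_split\<close>. Truncated subtraction
  makes the second vanish at \<open>j = 0\<close>, so for a fragmentation only the dissipation
  remains; for \<open>j \<ge> 1\<close> it lets the weight control the acceptor size as
  well.\<close>

fun weight :: "nat \<times> nat \<times> nat \<Rightarrow> real" where
  "weight (p, j, k) = (d (p - 1) - d 0) + (d (j - 1) - d 0)"

text \<open>The exponential rate in the moment bound. The number 48 is twice 24, where 24 consists
  of 16 for the gain of \<open>g\<close> and 8 for the weight.\<close>

definition growth :: real where "growth = 48 * C * QQ * mass"
definition moment :: real where "moment = (\<Sum>i. g i * cin i)"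

lemma weight_nonneg: "0 \<le> weight r"
  using d_le[of 0] by (cases r) (simp only: weight.simps, intro add_nonneg_nonneg, simp_all)

lemma summable_moment: "summable (\<lambda>i. g i * cin i)"
proof (rule summable_comparison_test'[OF d_cin])
  show "norm (g i * cin i) \<le> d i * (real i * cin i)" if "0 \<le> i" for i
    using mult_right_mono[OF g_le[of i] cin_nonneg[of i]] g_nonneg[of i] cin_nonneg[of i]
    by (simp add: mult_ac)
qed

text \<open>As \<open>j + k \<le> 2 * j * k\<close> for positive \<open>j\<close> and
  \<open>k\<close>, the bound on the rates acquires the factor \<open>k\<close> that
  \<open>q_sum\<close> asks for.\<close>

lemma sum_a_le:
  assumes "1 \<le> p" "1 \<le> j" shows "(\<Sum>k=1..p. a p j k) \<le> 2 * C * QQ * (real p * real j)"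
proof -
  have "(\<Sum>k=1..p. a p j k) \<le> (\<Sum>k=1..p. 2 * C * real j * (real k * real (p - k + 1) * q p k))"
  proof (rule sum_mono)
    fix k assume k: "k \<in> {1..p}"
    have "real j + real k \<le> 2 * real j * real k"
    proof -
      have "0 \<le> (real j - 1) * real k" "0 \<le> real j * (real k - 1)" using k assms by auto
      then show ?thesis by (simp add: algebra_simps)
    qed
    moreover have "0 \<le> C * real (p - k + 1) * q p k" using C_ge q_nonneg[of k p] k by simp
    ultimately have "(C * real (p - k + 1) * q p k) * (real j + real k)
        \<le> (C * real (p - k + 1) * q p k) * (2 * real j * real k)"
      by (rule mult_left_mono)
    then show "a p j k \<le> 2 * C * real j * (real k * real (p - k + 1) * q p k)"
      using a_le[of k p j] k assms by (simp add: mult_ac)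
  qed
  also have "\<dots> = 2 * C * real j * (\<Sum>k=1..p. real k * real (p - k + 1) * q p k)"
    by (simp add: sum_distrib_left)
  also have "\<dots> \<le> 2 * C * real j * (QQ * real p)"
    using q_sum assms C_ge by (intro mult_left_mono) auto
  finally show ?thesis by (simp add: mult_ac)
qed

text \<open>Multiplication by \<open>p\<close> allows \<open>g_star\<close> to replace
  \<open>real p * g k\<close> by \<open>real k * g p\<close>. Then every term carries the factor
  \<open>k\<close>, and \<open>q_sum\<close> returns a factor \<open>p\<close>, which cancels. Terms
  with nonpositive gain are simply dropped.\<close>

lemma sum_a_gain_le:
  assumes "1 \<le> p" "1 \<le> j"
  shows "(\<Sum>k=1..p. a p j k * gain g (p, j, k)) \<le> 16 * C * QQ * (real j * g p + real p * g j)"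
proof -
  define S where "S = real j * g p + real p * g j"
  have S: "0 \<le> S" by (simp add: S_def g_nonneg)
  have "real p * (\<Sum>k=1..p. a p j k * gain g (p, j, k)) = (\<Sum>k=1..p. real p * (a p j k * gain g (p, j, k)))"
    by (rule sum_distrib_left)
  also have "\<dots> \<le> (\<Sum>k=1..p. 16 * C * S * (real k * real (p - k + 1) * q p k))"
  proof (rule sum_mono)
    fix k assume k: "k \<in> {1..p}"
    define z where "z = C * real (p - k + 1) * q p k"
    have z: "0 \<le> z" using C_ge q_nonneg[of k p] k by (simp add: z_def)
    have R: "16 * C * S * (real k * real (p - k + 1) * q p k) = z * (16 * (real k * S))"
      by (simp add: z_def mult_ac)
    show "real p * (a p j k * gain g (p, j, k)) \<le> 16 * C * S * (real k * real (p - k + 1) * q p k)"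
    proof (cases "gain g (p, j, k) \<le> 0")
      case True
      then have "real p * (a p j k * gain g (p, j, k)) \<le> 0"
        using a_nonneg[of k p j] k by (intro mult_nonneg_nonpos) auto
      also have "0 \<le> z * (16 * (real k * S))" using z S by simp
      finally show ?thesis unfolding R .
    next
      case False
      have "a p j k \<le> z * real (j + k)" using a_le[of k p j] k assms by (simp add: z_def mult_ac)
      then have "a p j k * gain g (p, j, k) \<le> z * real (j + k) * gain g (p, j, k)"
        using False by (intro mult_right_mono) auto
      \<comment> \<open>The donor loses at least \<open>g k\<close>, by superadditivity; only the
        merging of \<open>k\<close> with \<open>j\<close> can increase the moment.\<close>
      also have "\<dots> \<le> z * real (j + k) * (g (j + k) - g j - g k)"
        using z k g_superadd[of "p - k" k] by (intro mult_left_mono) auto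
      also have "\<dots> \<le> z * (16 * (real j * g k + real k * g j))"
        using mult_left_mono[OF g_merge[of j k] z] by (simp only: mult.assoc)
      finally have "real p * (a p j k * gain g (p, j, k)) \<le> real p * (z * (16 * (real j * g k + real k * g j)))"
        by (rule mult_left_mono) simp
      also have "\<dots> = z * (16 * (real j * (real p * g k) + real k * (real p * g j)))"
        by (simp add: algebra_simps)
      also have "\<dots> \<le> z * (16 * (real j * (real k * g p) + real k * (real p * g j)))"
        using g_star[of k p] k z by (intro mult_left_mono add_right_mono) auto
      also have "\<dots> = z * (16 * (real k * S))" by (simp add: S_def algebra_simps)
      finally show ?thesis unfolding R .
    qed
  qed
  also have "\<dots> = 16 * C * S * (\<Sum>k=1..p. real k * real (p - k + 1) * q p k)"
    by (rule sum_distrib_left[symmetric])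
  also have "\<dots> \<le> 16 * C * S * (QQ * real p)"
    using q_sum assms C_ge S by (intro mult_left_mono) auto
  also have "\<dots> = real p * (16 * C * QQ * S)" by simp
  finally show ?thesis using assms by (simp add: S_def)
qed

text \<open>For a fragmentation the gain is at most minus the weight, whatever the size of the
  coefficient. For \<open>j \<ge> 1\<close> the growth condition bounds both the gain and the
  weight, the latter through \<open>d_le_g\<close>.\<close>

lemma sum_flux_gain_weight:
  assumes u: "\<And>i. 0 \<le> u i"
  shows "(\<Sum>k=1..p. flux u (p, j, k) * (gain g (p, j, k) + weight (p, j, k)))
    \<le> 24 * C * QQ * ((real j * g p + real p * g j) * (u p * u j))"
proof (cases "j = 0 \<or> p = 0")
  case True
  have "flux u (p, j, k) * (gain g (p, j, k) + weight (p, j, k)) \<le> 0" if k: "k \<in> {1..p}" for k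
  \<comment> \<open>A transfer of the whole cluster to size 0 dissipates nothing, but its
    coefficient \<open>a p 0 p\<close> vanishes.\<close>
  proof (cases "k = p")
    case True
    then show ?thesis using \<open>j = 0 \<or> p = 0\<close> k a_0[of p] by (auto simp: exch_def)
  next
    case False
    then have "gain g (p, j, k) + weight (p, j, k) \<le> 0"
      using g_split[of k p] k \<open>j = 0 \<or> p = 0\<close> by auto
    then show ?thesis using flux_nonneg[of "(p, j, k)" u] k u
      by (intro mult_nonneg_nonpos) (auto simp: reactions_def)
  qed
  then have "(\<Sum>k=1..p. flux u (p, j, k) * (gain g (p, j, k) + weight (p, j, k))) \<le> 0"
    by (rule sum_nonpos)
  also have "0 \<le> 24 * C * QQ * ((real j * g p + real p * g j) * (u p * u j))"
    using C_ge QQ_ge u g_nonneg by simp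
  finally show ?thesis .
next
  case False
  then have pj: "1 \<le> p" "1 \<le> j" by auto
  define S where "S = real j * g p + real p * g j"
  define w where "w = d p + d j"
  have w: "weight (p, j, k) \<le> w" for k
    using d_le[of "p - 1" p] d_le[of "j - 1" j] d_nonneg[of 0] by (simp add: w_def)
  have wS: "real p * real j * w \<le> 4 * S"
    using mult_left_mono[OF d_le_g[of p], of "real j"] mult_left_mono[OF d_le_g[of j], of "real p"]
    by (simp add: w_def S_def algebra_simps)
  have w0: "0 \<le> w" by (simp add: w_def d_nonneg)
  have "(\<Sum>k=1..p. a p j k * (gain g (p, j, k) + weight (p, j, k)))
    \<le> (\<Sum>k=1..p. a p j k * gain g (p, j, k) + a p j k * w)"
    using w a_nonneg by (intro sum_mono) (auto simp: distrib_left mult_left_mono simp del: gain.simps weight.simps)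
  also have "\<dots> = (\<Sum>k=1..p. a p j k * gain g (p, j, k)) + (\<Sum>k=1..p. a p j k) * w"
    by (simp add: sum.distrib sum_distrib_right)
  also have "\<dots> \<le> 16 * C * QQ * S + 2 * C * QQ * (real p * real j) * w"
    using sum_a_gain_le[OF pj] mult_right_mono[OF sum_a_le[OF pj] w0] unfolding S_def by linarith
  also have "\<dots> = 16 * C * QQ * S + 2 * C * QQ * (real p * real j * w)" by simp
  also have "\<dots> \<le> 16 * C * QQ * S + 2 * C * QQ * (4 * S)"
    using wS C_ge QQ_ge by (intro add_left_mono mult_left_mono) auto
  also have "\<dots> = 24 * C * QQ * S" by simp
  finally have "(\<Sum>k=1..p. a p j k * (gain g (p, j, k) + weight (p, j, k))) * (u p * u j)
      \<le> 24 * C * QQ * S * (u p * u j)"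
    using u by (intro mult_right_mono) auto
  then show ?thesis by (simp add: S_def exch_def sum_distrib_left sum_distrib_right mult_ac)
qed

text \<open>The quadratic expression factorizes: both double sums equal mass times moment, so the
  bound is linear in the moment.\<close>

lemma sum_reactions_gain_weight:
  assumes u: "\<And>i. 0 \<le> u i" and mass: "(\<Sum>i\<le>2*n. real i * u i) \<le> mass"
  shows "(\<Sum>r\<in>reactions_upto n. flux u r * (gain g r + weight r)) \<le> growth * (\<Sum>i\<le>2*n. g i * u i)"
proof -
  define P where "P = (\<Sum>i\<le>n. real i * u i)"
  define G where "G = (\<Sum>i\<le>n. g i * u i)"
  have P: "P \<le> mass"
    using mass sum_mono2[of "{..2*n}" "{..n}" "\<lambda>i. real i * u i"] u by (auto simp: P_def)
  have G: "G \<le> (\<Sum>i\<le>2*n. g i * u i)"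
    unfolding G_def using u g_nonneg by (intro sum_mono2) auto
  have G0: "0 \<le> G" unfolding G_def by (intro sum_nonneg mult_nonneg_nonneg u g_nonneg)
  have "(\<Sum>r\<in>reactions_upto n. flux u r * (gain g r + weight r))
    \<le> (\<Sum>p\<le>n. \<Sum>j\<le>n. 24 * C * QQ * ((real j * g p + real p * g j) * (u p * u j)))"
    unfolding sum_reactions_upto by (intro sum_mono sum_flux_gain_weight u)
  also have "\<dots> = 24 * C * QQ * ((\<Sum>p\<le>n. \<Sum>j\<le>n. (g p * u p) * (real j * u j)) +
      (\<Sum>p\<le>n. \<Sum>j\<le>n. (real p * u p) * (g j * u j)))"
    by (simp add: sum_distrib_left sum.distrib[symmetric] algebra_simps)
  also have "\<dots> = 48 * C * QQ * (P * G)"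
    by (simp add: sum_product[symmetric] P_def[symmetric] G_def[symmetric])
  also have "\<dots> \<le> 48 * C * QQ * (mass * (\<Sum>i\<le>2*n. g i * u i))"
    using P G G0 C_ge QQ_ge mass_nonneg by (intro mult_left_mono mult_mono) auto
  finally show ?thesis by (simp add: growth_def)
qed

lemma growth_nonneg: "0 \<le> growth" using C_ge QQ_ge mass_nonneg by (simp add: growth_def)

lemma moment_nonneg: "0 \<le> moment"
  unfolding moment_def by (intro suminf_nonneg summable_moment mult_nonneg_nonneg g_nonneg cin_nonneg)

text \<open>A discrete Gronwall argument with \<open>1 + x \<le> exp x\<close>. The accumulated
  weighted fluxes stay on the left, because the estimate bounds gain plus weight and not the gain
  alone.\<close>

lemma euler_moment:
  assumes h: "0 \<le> h" "2 * h * bound * (\<Sum>r\<in>reactions_upto n. coeff r) \<le> 1"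
  shows "(\<Sum>i\<le>2*n. g i * euler n h m i) + (\<Sum>r\<in>reactions_upto n. weight r * (h * (\<Sum>l<m. flux (euler n h l) r)))
    \<le> moment * exp (growth * (h * real m))"
proof (induction m)
  case 0
  have "(\<Sum>i\<le>2*n. g i * cin i) \<le> moment" unfolding moment_def
    by (intro sum_le_suminf summable_moment) (auto intro: mult_nonneg_nonneg g_nonneg cin_nonneg)
  then show ?case by simp
next
  case (Suc m)
  define u where "u = euler n h m"
  define E where "E = (\<Sum>r\<in>reactions_upto n. weight r * (h * (\<Sum>l<m. flux (euler n h l) r)))"
  define G where "G = (\<Sum>i\<le>2*n. g i * u i)"
  have u: "\<And>i. 0 \<le> u i" "(\<Sum>i\<le>2*n. real i * u i) \<le> mass"
    using euler_invariant[OF h, of m] unfolding u_def by auto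
  have E: "0 \<le> E" unfolding E_def
    using h(1) euler_invariant[OF h] subsetD[OF reactions_upto_subset]
    by (intro sum_nonneg mult_nonneg_nonneg flux_nonneg weight_nonneg) simp_all
  have "(\<Sum>i\<le>2*n. g i * euler n h (Suc m) i) + (\<Sum>r\<in>reactions_upto n. weight r * (h * (\<Sum>l<Suc m. flux (euler n h l) r)))
     = G + E + h * (\<Sum>r\<in>reactions_upto n. flux u r * (gain g r + weight r))"
    unfolding euler_weak[of g, OF g_0] E_def G_def u_def
    by (simp add: algebra_simps sum.distrib sum_distrib_left del: euler.simps)
  also have "\<dots> \<le> G + E + h * (growth * G)"
    using sum_reactions_gain_weight[OF u] h(1) unfolding G_def by (intro add_left_mono mult_left_mono) auto
  also have "\<dots> \<le> (G + E) * (1 + growth * h)"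
    using E h(1) growth_nonneg by (simp add: algebra_simps)
  also have "\<dots> \<le> (moment * exp (growth * (h * real m))) * exp (growth * h)"
    using Suc[folded u_def, folded G_def E_def] exp_ge_add_one_self[of "growth * h"] growth_nonneg h(1) moment_nonneg
    by (intro mult_mono) auto
  also have "\<dots> = moment * exp (growth * (h * real (Suc m)))"
    by (simp add: mult_exp_exp algebra_simps)
  finally show ?case .
qed

lemma euler_weight_le:
  assumes h: "0 \<le> h" "2 * h * bound * (\<Sum>r\<in>reactions_upto n. coeff r) \<le> 1" and T: "h * real m \<le> T"
  shows "(\<Sum>r\<in>reactions_upto n. weight r * (h * (\<Sum>l<m. flux (euler n h l) r))) \<le> moment * exp (growth * T)"
proof -
  have "0 \<le> (\<Sum>i\<le>2*n. g i * euler n h m i)"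
    using euler_invariant[OF h] by (intro sum_nonneg mult_nonneg_nonneg g_nonneg) auto
  then have "(\<Sum>r\<in>reactions_upto n. weight r * (h * (\<Sum>l<m. flux (euler n h l) r)))
      \<le> moment * exp (growth * (h * real m))"
    using euler_moment[OF h, of m] by linarith
  also have "\<dots> \<le> moment * exp (growth * T)"
    using T growth_nonneg moment_nonneg by (intro mult_left_mono) (auto simp: mult_left_mono)
  finally show ?thesis .
qed

text \<open>Since \<open>d\<close> tends to infinity and neither term of the weight is negative,
  \<open>p\<close> and \<open>j\<close> are bounded, and \<open>k \<le> p\<close>. This turns the
  weighted flux bound into tightness.\<close>

lemma finite_weight_le: "finite {r \<in> reactions. weight r \<le> B}"
proof -
  have "eventually (\<lambda>l. B + 2 * d 0 < d l) sequentially"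
    using d_lim by (simp add: filterlim_at_top_dense)
  then obtain L where L: "\<And>l. l \<ge> L \<Longrightarrow> B + 2 * d 0 < d l"
    unfolding eventually_sequentially by blast
  have "p \<le> Suc L \<and> j \<le> Suc L" if "weight (p, j, k) \<le> B" for p j k
  proof -
    have "\<not> L \<le> p - 1" "\<not> L \<le> j - 1"
      using that L[of "p - 1"] L[of "j - 1"] d_le[of 0 "p - 1"] d_le[of 0 "j - 1"] d_ge[of 0] by auto
    then show ?thesis by linarith
  qed
  then have "{r \<in> reactions. weight r \<le> B} \<subseteq> reactions_upto (Suc L)"
    by (auto simp: reactions_def reactions_upto_def simp del: weight.simps)
  then show ?thesis using finite_subset finite_reactions_upto by blast
qed

end

subsection \<open>Compactness\<close>

text \<open>On the finite set where \<open>W r \<le> B\<close> convergence is termwise; off this set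
  the approximations and the limit both have total at most \<open>K / B\<close>.\<close>

lemma tight_sum_tendsto:
  fixes x :: "nat \<Rightarrow> 'r \<Rightarrow> real" and y W \<phi> :: "'r \<Rightarrow> real"
  assumes A: "\<And>n. finite (A n)" "\<And>n. A n \<subseteq> I" "\<And>n r. r \<notin> A n \<Longrightarrow> x n r = 0"
    and x: "\<And>n r. r \<in> I \<Longrightarrow> 0 \<le> x n r" "\<And>r. r \<in> I \<Longrightarrow> (\<lambda>n. x n r) \<longlonglongrightarrow> y r"
    and W: "\<And>r. 0 \<le> W r" "\<And>B. finite {r \<in> I. W r \<le> B}"
    and K: "\<And>n. (\<Sum>r\<in>A n. W r * x n r) \<le> K"
    and \<phi>: "\<And>r. \<bar>\<phi> r\<bar> \<le> b"
  shows "y summable_on I" "(\<lambda>n. \<Sum>r\<in>A n. \<phi> r * x n r) \<longlonglongrightarrow> (\<Sum>\<^sub>\<infinity>r\<in>I. \<phi> r * y r)"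
proof -
  have b: "0 \<le> b" using \<phi>[of undefined] by linarith
  have K0: "0 \<le> K"
    using K[of 0] sum_nonneg[of "A 0" "\<lambda>r. W r * x 0 r"] W(1) x(1) A(2)[of 0] by fastforce
  have restr: "(\<Sum>r\<in>F. f r * x n r) = (\<Sum>r\<in>F \<inter> A n. f r * x n r)" if "finite F" for F n f
    using that A(3) by (intro sum.mono_neutral_right) auto
  have y0: "0 \<le> y r" if "r \<in> I" for r
    using x(2)[OF that] x(1)[OF that] by (intro LIMSEQ_le_const) auto
  \<comment> \<open>A Fatou argument: the weighted bound passes to the limit on each finite set of
    indices.\<close>
  have Wy: "(\<Sum>r\<in>F. W r * y r) \<le> K" if F: "finite F" "F \<subseteq> I" for F
  proof (rule LIMSEQ_le_const2)
    show "(\<lambda>n. \<Sum>r\<in>F. W r * x n r) \<longlonglongrightarrow> (\<Sum>r\<in>F. W r * y r)"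
      using F x(2) by (intro tendsto_intros) auto
    have "(\<Sum>r\<in>F. W r * x n r) \<le> K" for n
    proof -
      have "(\<Sum>r\<in>F \<inter> A n. W r * x n r) \<le> (\<Sum>r\<in>A n. W r * x n r)"
        using A(1)[of n] x(1)[OF subsetD[OF A(2)], of _ n] W(1)
        by (intro sum_mono2) (auto intro!: mult_nonneg_nonneg)
      then show ?thesis using restr[OF F(1), of W n] K[of n] by linarith
    qed
    then show "\<exists>N. \<forall>n\<ge>N. (\<Sum>r\<in>F. W r * x n r) \<le> K" by blast
  qed
  define FB where "FB B = {r \<in> I. W r \<le> B}" for B
  have FB: "finite (FB B)" "FB B \<subseteq> I" for B using W(2) by (auto simp: FB_def)
  have tail: "B * sum y F \<le> K" if "finite F" "F \<subseteq> I - FB B" for B F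
  proof -
    have "B * sum y F \<le> (\<Sum>r\<in>F. W r * y r)"
      unfolding sum_distrib_left using that y0 by (intro sum_mono mult_right_mono) (auto simp: FB_def)
    also have "\<dots> \<le> K" using that by (intro Wy) auto
    finally show ?thesis .
  qed
  show y_sum: "y summable_on I"
  proof (rule nonneg_bdd_above_summable_on)
    show "0 \<le> y r" if "r \<in> I" for r using y0 that .
    have "sum y F \<le> sum y (FB 1) + K" if F: "F \<subseteq> I" "finite F" for F
    proof -
      have "sum y F = sum y (F \<inter> FB 1) + sum y (F - FB 1)"
        by (metis F(2) sum.Int_Diff)
      moreover have "sum y (F \<inter> FB 1) \<le> sum y (FB 1)"
        using FB y0 by (intro sum_mono2) auto
      moreover have "sum y (F - FB 1) \<le> K" using tail[of "F - FB 1" 1] F by auto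
      ultimately show ?thesis by linarith
    qed
    then show "bdd_above (sum y ` {F. F \<subseteq> I \<and> finite F})"
      by (intro bdd_aboveI[of _ "sum y (FB 1) + K"]) auto
  qed
  have \<phi>y_le: "norm (\<phi> r * y r) \<le> b * y r" if "r \<in> I" for r
    using mult_right_mono[OF \<phi>[of r] y0[OF that]] y0[OF that] by (simp add: abs_mult)
  have norm_sum: "(\<lambda>r. norm (\<phi> r * y r)) summable_on S" if "S \<subseteq> I" for S
  proof (rule summable_on_comparison_test)
    show "(\<lambda>r. b * y r) summable_on S"
      using summable_on_subset_banach[OF y_sum that] by (rule summable_on_cmult_right)
    show "norm (\<phi> r * y r) \<le> b * y r" if "r \<in> S" for r
      using that \<open>S \<subseteq> I\<close> \<phi>y_le by blast
  qed simp
  have \<phi>y: "(\<lambda>r. \<phi> r * y r) summable_on S" if "S \<subseteq> I" for S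
    by (rule abs_summable_summable[OF norm_sum[OF that]])
  have lim_tail: "\<bar>(\<Sum>\<^sub>\<infinity>r\<in>I. \<phi> r * y r) - (\<Sum>r\<in>FB B. \<phi> r * y r)\<bar> \<le> b * (K / B)" if "0 < B" for B
  proof -
    have "(\<Sum>\<^sub>\<infinity>r\<in>I. \<phi> r * y r) = (\<Sum>\<^sub>\<infinity>r\<in>FB B \<union> (I - FB B). \<phi> r * y r)"
      using FB by (metis Un_Diff_cancel sup.absorb2)
    also have "\<dots> = (\<Sum>r\<in>FB B. \<phi> r * y r) + (\<Sum>\<^sub>\<infinity>r\<in>I - FB B. \<phi> r * y r)"
      using FB \<phi>y by (subst infsum_Un_disjoint) auto
    finally have "\<bar>(\<Sum>\<^sub>\<infinity>r\<in>I. \<phi> r * y r) - (\<Sum>r\<in>FB B. \<phi> r * y r)\<bar> = norm (\<Sum>\<^sub>\<infinity>r\<in>I - FB B. \<phi> r * y r)"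
      by simp
    also have "\<dots> \<le> (\<Sum>\<^sub>\<infinity>r\<in>I - FB B. norm (\<phi> r * y r))"
      by (intro norm_infsum_bound norm_sum) auto
    also have "\<dots> \<le> b * (K / B)"
    proof (rule infsum_le_finite_sums)
      show "(\<lambda>r. norm (\<phi> r * y r)) summable_on I - FB B" by (rule norm_sum) auto
      fix F assume F: "finite F" "F \<subseteq> I - FB B"
      have "(\<Sum>r\<in>F. norm (\<phi> r * y r)) \<le> (\<Sum>r\<in>F. b * y r)"
        using F by (intro sum_mono \<phi>y_le) auto
      also have "\<dots> = b * sum y F" by (simp add: sum_distrib_left)
      also have "\<dots> \<le> b * (K / B)" using tail[OF F] that b by (intro mult_left_mono) (auto simp: field_simps)
      finally show "(\<Sum>r\<in>F. norm (\<phi> r * y r)) \<le> b * (K / B)" .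
    qed
    finally show ?thesis .
  qed
  have app_tail: "\<bar>(\<Sum>r\<in>A n. \<phi> r * x n r) - (\<Sum>r\<in>FB B. \<phi> r * x n r)\<bar> \<le> b * (K / B)" if "0 < B" for B n
  proof -
    have "(\<Sum>r\<in>A n. \<phi> r * x n r) - (\<Sum>r\<in>FB B. \<phi> r * x n r) = (\<Sum>r\<in>A n - FB B. \<phi> r * x n r)"
      unfolding restr[OF FB(1)] using sum.Int_Diff[OF A(1)[of n], of "\<lambda>r. \<phi> r * x n r" "FB B"]
      by (simp add: Int_commute)
    also have "\<bar>\<dots>\<bar> \<le> (\<Sum>r\<in>A n - FB B. \<bar>\<phi> r * x n r\<bar>)" by (rule sum_abs)
    also have "\<dots> \<le> (\<Sum>r\<in>A n - FB B. b / B * (W r * x n r))"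
    proof (rule sum_mono)
      fix r assume r: "r \<in> A n - FB B"
      then have "r \<in> I" "B \<le> W r" using A(2)[of n] by (auto simp: FB_def)
      have "\<bar>\<phi> r * x n r\<bar> \<le> b * x n r"
        using \<phi>[of r] x(1)[OF \<open>r \<in> I\<close>, of n] by (simp add: abs_mult mult_right_mono)
      also have "\<dots> = b / B * (B * x n r)" using that by simp
      also have "\<dots> \<le> b / B * (W r * x n r)"
        using \<open>B \<le> W r\<close> x(1)[OF \<open>r \<in> I\<close>, of n] b that by (intro mult_left_mono mult_right_mono) auto
      finally show "\<bar>\<phi> r * x n r\<bar> \<le> b / B * (W r * x n r)" .
    qed
    also have "\<dots> = b / B * (\<Sum>r\<in>A n - FB B. W r * x n r)" by (simp add: sum_distrib_left)
    also have "\<dots> \<le> b / B * K"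
    proof (rule mult_left_mono)
      have "(\<Sum>r\<in>A n - FB B. W r * x n r) \<le> (\<Sum>r\<in>A n. W r * x n r)"
        using A(1)[of n] x(1)[OF subsetD[OF A(2)], of _ n] W(1)
        by (intro sum_mono2) (auto intro!: mult_nonneg_nonneg)
      then show "(\<Sum>r\<in>A n - FB B. W r * x n r) \<le> K" using K[of n] by linarith
    qed (use b that in simp)
    finally show ?thesis by simp
  qed
  show "(\<lambda>n. \<Sum>r\<in>A n. \<phi> r * x n r) \<longlonglongrightarrow> (\<Sum>\<^sub>\<infinity>r\<in>I. \<phi> r * y r)"
  proof (rule LIMSEQ_I)
    fix e :: real assume e: "0 < e"
    \<comment> \<open>Both tails become smaller than \<open>e / 3\<close>; the added 1 keeps
      \<open>B\<close> positive when \<open>b * K = 0\<close>.\<close>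
    define B where "B = 3 * (b * K + 1) / e"
    have bK: "0 \<le> b * K" using b K0 by simp
    have B: "0 < B" using bK e by (simp add: B_def)
    have small: "b * (K / B) < e / 3"
      using bK e by (simp add: B_def field_simps)
    have "(\<lambda>n. \<Sum>r\<in>FB B. \<phi> r * x n r) \<longlonglongrightarrow> (\<Sum>r\<in>FB B. \<phi> r * y r)"
      using FB x(2) by (intro tendsto_intros) auto
    from LIMSEQ_D[OF this, of "e / 3"] e
    obtain N where N: "\<And>n. n \<ge> N \<Longrightarrow> norm ((\<Sum>r\<in>FB B. \<phi> r * x n r) - (\<Sum>r\<in>FB B. \<phi> r * y r)) < e / 3"
      by auto
    have "norm ((\<Sum>r\<in>A n. \<phi> r * x n r) - (\<Sum>\<^sub>\<infinity>r\<in>I. \<phi> r * y r)) < e" if "n \<ge> N" for n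
      using N[OF that] app_tail[OF B, of n] lim_tail[OF B] small unfolding real_norm_def by linarith
    then show "\<exists>N. \<forall>n\<ge>N. norm ((\<Sum>r\<in>A n. \<phi> r * x n r) - (\<Sum>\<^sub>\<infinity>r\<in>I. \<phi> r * y r)) < e" by blast
  qed
qed

text \<open>Identifies an Euler sum with the integral of the piecewise constant interpolant.\<close>

lemma has_integral_step_function:
  fixes F :: "nat \<Rightarrow> real"
  assumes h: "0 < h"
  shows "((\<lambda>s. F (nat \<lfloor>s / h\<rfloor>)) has_integral h * (\<Sum>l<N. F l)) {0..h * real N}"
proof (induction N)
  case 0
  then show ?case by (simp add: has_integral_refl)
next
  case (Suc N)
  have "((\<lambda>s. F (nat \<lfloor>s / h\<rfloor>)) has_integral h * F N) {h * real N..h * real (Suc N)}"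
  \<comment> \<open>At the right endpoint the floor has already moved on to \<open>Suc N\<close>; a
    single point does not affect the integral.\<close>
  proof (rule has_integral_spike_finite[where S = "{h * real (Suc N)}" and f = "\<lambda>_. F N"])
    show "((\<lambda>_. F N) has_integral h * F N) {h * real N..h * real (Suc N)}"
      using has_integral_const_real[of "F N" "h * real N" "h * real (Suc N)"] h
      by (simp add: algebra_simps)
    show "F (nat \<lfloor>s / h\<rfloor>) = F N" if "s \<in> {h * real N..h * real (Suc N)} - {h * real (Suc N)}" for s
    proof -
      have "\<lfloor>s / h\<rfloor> = int N" using that h by (intro floor_unique) (auto simp: field_simps)
      then show ?thesis by simp
    qed
  qed auto
  from has_integral_combine[OF _ _ Suc.IH this] h show ?case
    by (simp add: distrib_left)
qed

section \<open>Interpolated approximations and a convergent subsequence\<close>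

context weighted_exchange
begin

text \<open>The second factor of the denominator ensures the stability condition of
  \<open>euler_invariant\<close>, the first makes the steps tend to 0.\<close>

definition step :: "nat \<Rightarrow> real" where
  "step n = 1 / ((real n + 1) * (1 + 2 * bound * (\<Sum>r\<in>reactions_upto n. coeff r)))"

definition tick :: "nat \<Rightarrow> real \<Rightarrow> nat" where "tick n t = nat \<lfloor>t / step n\<rfloor>"

definition approx :: "nat \<Rightarrow> real \<Rightarrow> nat \<Rightarrow> real" where
  "approx n t = euler n (step n) (tick n t)"

text \<open>The flux of \<open>r\<close> integrated over the completed steps. The value 0 outside
  the truncation lets all \<open>n\<close> share the index set \<open>reactions\<close>.\<close>

definition accum :: "nat \<Rightarrow> real \<Rightarrow> nat \<times> nat \<times> nat \<Rightarrow> real" where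
  "accum n t r = (if r \<in> reactions_upto n
     then step n * (\<Sum>l<tick n t. flux (euler n (step n) l) r) else 0)"

definition tail_bound :: "real \<Rightarrow> real" where
  "tail_bound T = moment * exp (growth * T)"

text \<open>Bounds the rate at which the finitely many reactions of weight at most \<open>B\<close>
  change one component; the 4 comes from \<open>abs_stoich_le\<close>.\<close>

definition speed :: "real \<Rightarrow> real" where
  "speed B = 4 * bound\<^sup>2 * (\<Sum>r | r \<in> reactions \<and> weight r \<le> B. coeff r)"

lemma sum_coeff_nonneg: "0 \<le> (\<Sum>r\<in>reactions_upto n. coeff r)"
  using coeff_nonneg subsetD[OF reactions_upto_subset] by (intro sum_nonneg) simp

lemma step_pos: "0 < step n"
  using sum_coeff_nonneg[of n] bound_nonneg by (simp add: step_def add_pos_nonneg)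

lemma step_le: "step n \<le> 1 / (real n + 1)"
proof -
  have "(real n + 1) * 1 \<le> (real n + 1) * (1 + 2 * bound * (\<Sum>r\<in>reactions_upto n. coeff r))"
    using sum_coeff_nonneg[of n] bound_nonneg by (intro mult_left_mono) auto
  then show ?thesis unfolding step_def by (intro frac_le) auto
qed

lemma step_stable: "2 * step n * bound * (\<Sum>r\<in>reactions_upto n. coeff r) \<le> 1"
proof -
  define S where "S = 2 * bound * (\<Sum>r\<in>reactions_upto n. coeff r)"
  have S: "0 \<le> S" using sum_coeff_nonneg[of n] bound_nonneg by (simp add: S_def)
  have "0 \<le> real n * S" using S by simp
  then have "S \<le> (real n + 1) * (1 + S)" using S by (simp add: algebra_simps)
  then have "S / ((real n + 1) * (1 + S)) \<le> 1" using S by (simp add: divide_le_eq_1)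
  then show ?thesis by (simp add: step_def S_def)
qed

lemma step_tendsto: "step \<longlonglongrightarrow> 0"
proof (rule tendsto_sandwich[OF _ _ tendsto_const])
  show "(\<lambda>n. 1 / (real n + 1)) \<longlonglongrightarrow> 0" using LIMSEQ_inverse_real_of_nat by (simp add: inverse_eq_divide add.commute)
  show "\<forall>\<^sub>F n in sequentially. 0 \<le> step n" by (simp add: less_imp_le step_pos)
  show "\<forall>\<^sub>F n in sequentially. step n \<le> 1 / (real n + 1)" by (simp add: step_le)
qed

lemma tick_le: "0 \<le> t \<Longrightarrow> step n * real (tick n t) \<le> t"
proof -
  assume "0 \<le> t"
  then have "real (tick n t) \<le> t / step n"
    using step_pos[of n] unfolding tick_def by (intro of_nat_floor) simp
  then show ?thesis using step_pos[of n] by (simp add: field_simps)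
qed

lemma tick_gt: "t - step n < step n * real (tick n t)"
proof -
  have "t / step n < real (tick n t) + 1" unfolding tick_def by linarith
  then show ?thesis using step_pos[of n] by (simp add: field_simps)
qed

lemma tick_mono: "s \<le> t \<Longrightarrow> tick n s \<le> tick n t"
  unfolding tick_def using step_pos[of n] by (intro nat_mono floor_mono divide_right_mono) auto

lemmas step_ok = less_imp_le[OF step_pos] step_stable

lemma euler_step_nonneg: "0 \<le> euler n (step n) m i"
  using euler_invariant[OF step_ok, where m=m] by blast

lemma approx_nonneg: "0 \<le> approx n t i"
  unfolding approx_def by (rule euler_step_nonneg)

lemma approx_le: "approx n t i \<le> bound"
  unfolding approx_def by (rule euler_le_bound[OF step_ok])

lemma approx_mass: "(\<Sum>i\<le>2*n. real i * approx n t i) \<le> mass"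
  unfolding approx_def using euler_invariant[OF step_ok] by blast

lemma approx_eq: "approx n t i = cin i + (\<Sum>r\<in>reactions_upto n. stoich i r * accum n t r)"
  by (subst approx_def, subst euler_eq) (simp add: accum_def)

lemma accum_mono:
  assumes "r \<in> reactions" "s \<le> t" shows "accum n s r \<le> accum n t r"
  using assms tick_mono[OF assms(2)] step_pos[of n] euler_step_nonneg
  by (auto simp: accum_def intro!: mult_left_mono sum_mono2 flux_nonneg)

lemma accum_nonneg: "r \<in> reactions \<Longrightarrow> 0 \<le> accum n t r"
  using step_pos[of n] euler_step_nonneg
  by (auto simp: accum_def intro!: mult_nonneg_nonneg sum_nonneg flux_nonneg)

text \<open>Rounding both times down to the grid lengthens the interval by at most one step, and the
  flux is bounded by \<open>flux_le\<close>.\<close>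

lemma accum_diff_le:
  assumes r: "r \<in> reactions" and st: "0 \<le> s" "s \<le> t"
  shows "accum n t r - accum n s r \<le> coeff r * bound\<^sup>2 * (t - s + step n)"
proof (cases "r \<in> reactions_upto n")
  case True
  define f where "f l = flux (euler n (step n) l) r" for l
  have f: "f l \<le> coeff r * bound\<^sup>2" for l
    unfolding f_def by (rule flux_le[OF r euler_step_nonneg euler_le_bound[OF step_ok]])
  have "sum f {..<tick n t} = sum f {..<tick n s} + sum f {tick n s..<tick n t}"
    using tick_mono[OF st(2)] by (metis lessThan_atLeast0 sum.atLeastLessThan_concat zero_le)
  then have "accum n t r - accum n s r = step n * sum f {tick n s..<tick n t}"
    using True by (simp add: accum_def f_def algebra_simps)
  also have "\<dots> \<le> step n * (real (card {tick n s..<tick n t}) * (coeff r * bound\<^sup>2))"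
    using step_pos[of n] f by (intro mult_left_mono sum_bounded_above) auto
  also have "\<dots> = coeff r * bound\<^sup>2 * (step n * real (tick n t) - step n * real (tick n s))"
    using tick_mono[OF st(2), of n] by (simp add: of_nat_diff algebra_simps)
  also have "\<dots> \<le> coeff r * bound\<^sup>2 * (t - s + step n)"
    using tick_le[of t n] tick_gt[of s n] st coeff_nonneg[OF r] by (intro mult_left_mono) auto
  finally show ?thesis .
next
  case False
  then show ?thesis using st step_pos[of n] coeff_nonneg[OF r] by (simp add: accum_def)
qed

lemma tail_bound_nonneg: "0 \<le> tail_bound T"
  unfolding tail_bound_def using moment_nonneg by simp

lemma accum_weight_le:
  assumes "0 \<le> t" "t \<le> T"
  shows "(\<Sum>r\<in>reactions_upto n. weight r * accum n t r) \<le> tail_bound T"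
  using euler_weight_le[OF step_ok, of n "tick n t" T] tick_le[OF assms(1), of n] assms(2)
  by (simp add: tail_bound_def accum_def)

lemma speed_nonneg: "0 \<le> speed B"
  unfolding speed_def using coeff_nonneg by (intro mult_nonneg_nonneg sum_nonneg) auto

text \<open>Reactions of weight at most \<open>B\<close> are finitely many and have bounded flux.
  The heavier ones together accumulate at most \<open>tail_bound T / B\<close>, independently of
  \<open>n\<close>.\<close>

lemma approx_equicontinuous:
  assumes st: "0 \<le> s" "s \<le> t" "t \<le> T" and B: "0 < B"
  shows "\<bar>approx n t i - approx n s i\<bar> \<le> speed B * (t - s + step n) + 4 * tail_bound T / B"
proof -
  define D where "D r = accum n t r - accum n s r" for r
  define \<delta> where "\<delta> = t - s + step n"
  have \<delta>: "0 \<le> \<delta>" using st step_pos[of n] by (simp add: \<delta>_def)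
  note sub = subsetD[OF reactions_upto_subset]
  have D0: "0 \<le> D r" if "r \<in> reactions" for r
    using accum_mono[OF that st(2)] by (simp add: D_def)
  have "approx n t i - approx n s i = (\<Sum>r\<in>reactions_upto n. stoich i r * D r)"
    unfolding approx_eq D_def by (simp add: right_diff_distrib sum_subtractf)
  also have "\<bar>\<dots>\<bar> \<le> (\<Sum>r\<in>reactions_upto n. \<bar>stoich i r * D r\<bar>)" by (rule sum_abs)
  also have "\<dots> \<le> (\<Sum>r\<in>reactions_upto n. 4 * D r)"
    using D0[OF sub] abs_stoich_le[of i] by (intro sum_mono) (simp add: abs_mult mult_right_mono)
  also have "\<dots> \<le> (\<Sum>r\<in>reactions_upto n. (if weight r \<le> B then 4 * (coeff r * bound\<^sup>2 * \<delta>) else 0)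
      + 4 / B * (weight r * accum n t r))"
  proof (rule sum_mono)
    fix r assume "r \<in> reactions_upto n"
    then have r: "r \<in> reactions" by (rule sub)
    have w: "0 \<le> weight r * accum n t r" using weight_nonneg accum_nonneg[OF r] by simp
    show "4 * D r \<le> (if weight r \<le> B then 4 * (coeff r * bound\<^sup>2 * \<delta>) else 0)
      + 4 / B * (weight r * accum n t r)"
    proof (cases "weight r \<le> B")
      case True
      have "0 \<le> 4 / B * (weight r * accum n t r)" using w B by simp
      then show ?thesis using True accum_diff_le[OF r st(1,2), of n] unfolding D_def \<delta>_def by simp
    next
      case False
      have "D r \<le> accum n t r" using accum_nonneg[OF r] by (simp add: D_def)
      then have "4 * D r \<le> 4 / B * (B * accum n t r)" using B by simp
      also have "\<dots> \<le> 4 / B * (weight r * accum n t r)"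
        using False B accum_nonneg[OF r] by (intro mult_left_mono mult_right_mono) auto
      finally show ?thesis using False by simp
    qed
  qed
  also have "\<dots> = (\<Sum>r\<in>reactions_upto n. (if weight r \<le> B then 4 * (coeff r * bound\<^sup>2 * \<delta>) else 0))
      + 4 / B * (\<Sum>r\<in>reactions_upto n. weight r * accum n t r)"
    by (simp add: sum.distrib sum_distrib_left)
  also have "\<dots> \<le> speed B * \<delta> + 4 / B * tail_bound T"
  proof (rule add_mono)
    have "(\<Sum>r\<in>reactions_upto n. (if weight r \<le> B then 4 * (coeff r * bound\<^sup>2 * \<delta>) else 0))
       = (\<Sum>r | r \<in> reactions_upto n \<and> weight r \<le> B. 4 * (coeff r * bound\<^sup>2 * \<delta>))"
      by (simp add: sum.inter_filter)
    also have "\<dots> \<le> (\<Sum>r | r \<in> reactions \<and> weight r \<le> B. 4 * (coeff r * bound\<^sup>2 * \<delta>))"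
      using finite_weight_le[of B] sub coeff_nonneg \<delta>
      by (intro sum_mono2) auto
    also have "\<dots> = speed B * \<delta>" by (simp add: speed_def sum_distrib_left sum_distrib_right mult_ac)
    finally show "(\<Sum>r\<in>reactions_upto n. (if weight r \<le> B then 4 * (coeff r * bound\<^sup>2 * \<delta>) else 0)) \<le> speed B * \<delta>" .
    show "4 / B * (\<Sum>r\<in>reactions_upto n. weight r * accum n t r) \<le> 4 / B * tail_bound T"
      using accum_weight_le[of t T n] st B by (intro mult_left_mono) auto
  qed
  finally show ?thesis by (simp add: \<delta>_def)
qed

text \<open>First \<open>B\<close> makes the contribution of heavy reactions less than
  \<open>e / 2\<close>, then \<open>\<delta>\<close> is chosen depending on \<open>B\<close>. The
  range \<open>2 * \<delta>\<close> leaves room for a time difference and a step, and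
  \<open>\<delta> < 1\<close> keeps nearby times below \<open>t + 1\<close>.\<close>

lemma modulus_small:
  assumes "0 < e"
  obtains B \<delta> where "0 < B" "0 < \<delta>" "\<delta> < 1"
    "\<And>x. 0 \<le> x \<Longrightarrow> x \<le> 2 * \<delta> \<Longrightarrow> speed B * x + 4 * tail_bound T / B < e"
proof -
  define B where "B = 8 * (tail_bound T + 1) / e"
  have B: "0 < B" using assms tail_bound_nonneg[of T] by (simp add: B_def add_nonneg_pos)
  have 1: "4 * tail_bound T / B < e / 2"
    using assms tail_bound_nonneg[of T] by (simp add: B_def field_simps)
  define \<delta> where "\<delta> = min (1/2) (e / (4 * (speed B + 1)))"
  have \<delta>: "0 < \<delta>" "\<delta> < 1" using assms speed_nonneg[of B] by (auto simp: \<delta>_def)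
  have "speed B * x \<le> e / 2" if "0 \<le> x" "x \<le> 2 * \<delta>" for x
  proof -
    have "x \<le> 2 * (e / (4 * (speed B + 1)))" using that by (simp add: \<delta>_def)
    then have "speed B * x \<le> (speed B + 1) * (2 * (e / (4 * (speed B + 1))))"
      using that speed_nonneg[of B] assms by (intro mult_mono) auto
    also have "\<dots> = e / 2" using speed_nonneg[of B] by (simp add: field_simps)
    finally show ?thesis .
  qed
  then have "speed B * x + 4 * tail_bound T / B < e" if "0 \<le> x" "x \<le> 2 * \<delta>" for x
    using that 1 by fastforce
  with B \<delta> show ?thesis by (rule that)
qed

text \<open>A diagonal subsequence converges for all sizes at nonnegative rational times; uniform
  near-equicontinuity carries the Cauchy property to every time.\<close>

lemma approx_subsequence:
  obtains \<kappa> c where "strict_mono (\<kappa> :: nat \<Rightarrow> nat)"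
    "\<And>t i. 0 \<le> t \<Longrightarrow> (\<lambda>n. approx (\<kappa> n) t i) \<longlonglongrightarrow> c t i"
proof -
  define S where "S = (\<rat> \<inter> {0::real..}) \<times> (UNIV :: nat set)"
  have "countable S" unfolding S_def by (intro countable_SIGMA countable_Int1 countable_rat) auto
  moreover have "norm (approx n (fst x) (snd x)) \<le> bound" if "x \<in> S" for n x
    using approx_nonneg approx_le by simp
  ultimately obtain \<kappa> where \<kappa>: "strict_mono (\<kappa> :: nat \<Rightarrow> nat)"
    and conv: "\<And>x. x \<in> S \<Longrightarrow> \<exists>l. (\<lambda>n. approx (\<kappa> n) (fst x) (snd x)) \<longlonglongrightarrow> l"
    by (rule function_convergent_subsequence[of S "\<lambda>n x. approx n (fst x) (snd x)" bound]) blast+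
  have step\<kappa>: "(\<lambda>n. step (\<kappa> n)) \<longlonglongrightarrow> 0"
    using LIMSEQ_subseq_LIMSEQ[OF step_tendsto \<kappa>] by (simp add: o_def)
  have "Cauchy (\<lambda>n. approx (\<kappa> n) t i)" if t: "0 \<le> t" for t i
  proof (rule metric_CauchyI)
    fix e :: real assume e: "0 < e"
    obtain B \<delta> where B: "0 < B" "0 < \<delta>" "\<delta> < 1"
      "\<And>x. 0 \<le> x \<Longrightarrow> x \<le> 2 * \<delta> \<Longrightarrow> speed B * x + 4 * tail_bound (t + 1) / B < e / 3"
      using modulus_small[of "e / 3" "t + 1"] e by (auto simp del: times_divide_eq_right)
    \<comment> \<open>A rational time after \<open>t\<close> is nonnegative and has the order that
      \<open>approx_equicontinuous\<close> expects.\<close>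
    obtain s where s: "s \<in> \<rat>" "t < s" "s < t + \<delta>" using Rats_dense_in_real[of t "t + \<delta>"] B by auto
    then have "(s, i) \<in> S" using t by (simp add: S_def)
    then have "Cauchy (\<lambda>n. approx (\<kappa> n) s i)" using conv convergent_Cauchy[unfolded convergent_def] by fastforce
    then obtain N1 where N1: "\<And>m n. m \<ge> N1 \<Longrightarrow> n \<ge> N1 \<Longrightarrow> dist (approx (\<kappa> m) s i) (approx (\<kappa> n) s i) < e / 3"
      using e metric_CauchyD[of _ "e/3"] by (metis divide_pos_pos zero_less_numeral)
    obtain N2 where N2: "\<And>n. n \<ge> N2 \<Longrightarrow> norm (step (\<kappa> n) - 0) < \<delta>"
      using LIMSEQ_D[OF step\<kappa> B(2)] by blast
    have close: "dist (approx (\<kappa> n) s i) (approx (\<kappa> n) t i) < e / 3" if "n \<ge> N2" for n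
    proof -
      have "\<bar>approx (\<kappa> n) s i - approx (\<kappa> n) t i\<bar> \<le> speed B * (s - t + step (\<kappa> n)) + 4 * tail_bound (t + 1) / B"
        using s B t by (intro approx_equicontinuous) auto
      also have "\<dots> < e / 3" using N2[OF that] step_pos[of "\<kappa> n"] s by (intro B(4)) auto
      finally show ?thesis by (simp add: dist_real_def)
    qed
    have "dist (approx (\<kappa> m) t i) (approx (\<kappa> n) t i) < e" if "m \<ge> max N1 N2" "n \<ge> max N1 N2" for m n
    proof -
      have "m \<ge> N1" "n \<ge> N1" "m \<ge> N2" "n \<ge> N2" using that by auto
      then show ?thesis using N1[of m n] close[of m] close[of n] unfolding dist_real_def by linarith
    qed
    then show "\<exists>N. \<forall>m\<ge>N. \<forall>n\<ge>N. dist (approx (\<kappa> m) t i) (approx (\<kappa> n) t i) < e" by blast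
  qed
  then have "\<forall>t i. \<exists>l. 0 \<le> t \<longrightarrow> (\<lambda>n. approx (\<kappa> n) t i) \<longlonglongrightarrow> l"
    using Cauchy_convergent_iff convergent_def by blast
  then obtain c where "\<And>t i. 0 \<le> t \<Longrightarrow> (\<lambda>n. approx (\<kappa> n) t i) \<longlonglongrightarrow> c t i" by metis
  with \<kappa> show ?thesis by (rule that)
qed

end

section \<open>Passage to the limit\<close>

locale exchange_limit = weighted_exchange +
  fixes \<kappa> :: "nat \<Rightarrow> nat" and c :: "real \<Rightarrow> nat \<Rightarrow> real"
  assumes \<kappa>: "strict_mono \<kappa>"
    and approx_tendsto: "\<And>t i. 0 \<le> t \<Longrightarrow> (\<lambda>n. approx (\<kappa> n) t i) \<longlonglongrightarrow> c t i"
begin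

lemma step_\<kappa>_tendsto: "(\<lambda>n. step (\<kappa> n)) \<longlonglongrightarrow> 0"
  using LIMSEQ_subseq_LIMSEQ[OF step_tendsto \<kappa>] by (simp add: o_def)

lemma eventually_\<kappa>: "eventually (\<lambda>n. m \<le> \<kappa> n) sequentially"
  using filterlim_subseq[OF \<kappa>] by (simp add: filterlim_at_top)

lemma eventually_reactions_upto:
  assumes "finite F" "F \<subseteq> reactions"
  shows "eventually (\<lambda>n. F \<subseteq> reactions_upto (\<kappa> n)) sequentially"
proof -
  have "eventually (\<lambda>n. r \<in> reactions_upto (\<kappa> n)) sequentially" if "r \<in> F" for r
  proof -
    obtain p j k where r: "r = (p, j, k)" by (cases r)
    show ?thesis using eventually_\<kappa>[of "max p j"]
      by eventually_elim (use assms that in \<open>auto simp: r reactions_def reactions_upto_def\<close>)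
  qed
  then have "eventually (\<lambda>n. \<forall>r\<in>F. r \<in> reactions_upto (\<kappa> n)) sequentially"
    using assms(1) by (simp add: eventually_ball_finite)
  then show ?thesis by (simp add: subset_eq)
qed

lemma c_nonneg: "0 \<le> t \<Longrightarrow> 0 \<le> c t i"
  using LIMSEQ_le_const[OF approx_tendsto] approx_nonneg by blast

text \<open>For fixed \<open>N\<close> the sum is finite and eventually covered by the range
  \<open>2 * \<kappa> n\<close> over which the approximations have controlled mass.\<close>

lemma c_mass:
  assumes "0 \<le> t" shows "(\<Sum>i<N. real i * c t i) \<le> mass"
proof (rule tendsto_upperbound)
  show "(\<lambda>n. \<Sum>i<N. real i * approx (\<kappa> n) t i) \<longlonglongrightarrow> (\<Sum>i<N. real i * c t i)"
    using approx_tendsto[OF assms] by (intro tendsto_intros)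
  show "eventually (\<lambda>n. (\<Sum>i<N. real i * approx (\<kappa> n) t i) \<le> mass) sequentially"
    using eventually_\<kappa>[of N]
  proof eventually_elim
    case (elim n)
    then have "(\<Sum>i<N. real i * approx (\<kappa> n) t i) \<le> (\<Sum>i\<le>2 * \<kappa> n. real i * approx (\<kappa> n) t i)"
      by (intro sum_mono2) (auto simp: approx_nonneg)
    then show ?case using approx_mass[of "\<kappa> n" t] by linarith
  qed
qed simp

lemma c_X01_pos:
  assumes "0 \<le> t" shows "c t \<in> X01_pos"
proof -
  have "summable (\<lambda>i. real i * c t i)"
    using c_mass[OF assms] c_nonneg[OF assms] by (intro summableI_nonneg_bounded) auto
  then have "summable (\<lambda>i. 2 * (real i * c t i))" by (rule summable_mult)
  then have "summable (\<lambda>i. (1 + real i) * \<bar>c t i\<bar>)"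
  proof (rule summable_comparison_test')
    fix i :: nat assume "1 \<le> i"
    then have "(1 + real i) * c t i \<le> (2 * real i) * c t i"
      using c_nonneg[OF assms] by (intro mult_right_mono) auto
    then show "norm ((1 + real i) * \<bar>c t i\<bar>) \<le> 2 * (real i * c t i)"
      using c_nonneg[OF assms, of i] by (simp add: mult.assoc)
  qed
  then show ?thesis using c_nonneg[OF assms] by (simp add: X01_pos_def X01_def del: abs_of_nonneg)
qed

lemma c_equicontinuous:
  assumes "0 \<le> s" "s \<le> t" "t \<le> T" "0 < B"
  shows "\<bar>c t i - c s i\<bar> \<le> speed B * (t - s) + 4 * tail_bound T / B"
proof (rule LIMSEQ_le)
  show "(\<lambda>n. \<bar>approx (\<kappa> n) t i - approx (\<kappa> n) s i\<bar>) \<longlonglongrightarrow> \<bar>c t i - c s i\<bar>"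
    using assms by (intro tendsto_intros approx_tendsto) auto
  have "(\<lambda>n. speed B * (t - s + step (\<kappa> n)) + 4 * tail_bound T / B) \<longlonglongrightarrow> speed B * (t - s + 0) + 4 * tail_bound T / B"
    by (intro tendsto_intros step_\<kappa>_tendsto)
  then show "(\<lambda>n. speed B * (t - s + step (\<kappa> n)) + 4 * tail_bound T / B) \<longlonglongrightarrow> speed B * (t - s) + 4 * tail_bound T / B"
    by simp
  show "\<exists>N. \<forall>n\<ge>N. \<bar>approx (\<kappa> n) t i - approx (\<kappa> n) s i\<bar> \<le> speed B * (t - s + step (\<kappa> n)) + 4 * tail_bound T / B"
    using approx_equicontinuous[OF assms] by blast
qed

lemma continuous_c: "continuous_on {0..} (\<lambda>t. c t i)"
proof (rule continuous_onI)
  fix t e :: real assume t: "t \<in> {0..}" and e: "0 < e"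
  obtain B \<delta> where B: "0 < B" "0 < \<delta>" "\<delta> < 1"
      "\<And>x. 0 \<le> x \<Longrightarrow> x \<le> 2 * \<delta> \<Longrightarrow> speed B * x + 4 * tail_bound (t + 1) / B < e"
    using modulus_small[OF e, of "t + 1"] by blast
  have *: "\<bar>c y i - c x i\<bar> < e" if "0 \<le> x" "x \<le> y" "y \<le> t + 1" "y - x < \<delta>" for x y
    using c_equicontinuous[OF that(1-3) B(1), of i] B(4)[of "y - x"] that by linarith
  have "dist (c s i) (c t i) \<le> e" if "s \<in> {0..}" "dist s t < \<delta>" for s
    using *[of s t] *[of t s] that t B by (cases "s \<le> t") (auto simp: dist_real_def)
  then show "\<exists>\<delta>>0. \<forall>s\<in>{0..}. dist s t < \<delta> \<longrightarrow> dist (c s i) (c t i) \<le> e" using B(2) by blast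
qed

lemma flux_c_nonneg: "r \<in> reactions \<Longrightarrow> 0 \<le> t \<Longrightarrow> 0 \<le> flux (c t) r"
  by (intro flux_nonneg c_nonneg)

lemma continuous_flux: "continuous_on {0..} (\<lambda>t. flux (c t) r)"
  by (cases r) (auto simp: exch_def intro!: continuous_intros continuous_c)

lemma flux_approx_tendsto: "0 \<le> t \<Longrightarrow> (\<lambda>n. flux (approx (\<kappa> n) t) r) \<longlonglongrightarrow> flux (c t) r"
  by (cases r) (auto simp: exch_def intro!: tendsto_intros approx_tendsto)

text \<open>The accumulated flux is the integral of the flux of the interpolant, and dominated
  convergence applies with the constant from \<open>flux_le\<close>.\<close>

lemma accum_tendsto:
  assumes r: "r \<in> reactions" and t: "0 \<le> t"
  shows "(\<lambda>n. accum (\<kappa> n) t r) \<longlonglongrightarrow> integral {0..t} (\<lambda>s. flux (c s) r)"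
proof -
  \<comment> \<open>The completed steps. The integrand is cut off on the unfinished last step, which
    shrinks away: each \<open>s < t\<close> eventually lies in \<open>X n\<close>.\<close>
  define X where "X n = {0<..<step (\<kappa> n) * real (tick (\<kappa> n) t)}" for n
  define f where "f n s = (if s \<in> X n then flux (approx (\<kappa> n) s) r else 0)" for n s
  have I: "(f n has_integral step (\<kappa> n) * (\<Sum>l<tick (\<kappa> n) t. flux (euler (\<kappa> n) (step (\<kappa> n)) l) r)) {0<..<t}" for n
  proof -
    have "((\<lambda>s. flux (approx (\<kappa> n) s) r) has_integral
        step (\<kappa> n) * (\<Sum>l<tick (\<kappa> n) t. flux (euler (\<kappa> n) (step (\<kappa> n)) l) r)) (X n)"
      using has_integral_step_function[OF step_pos, of "\<lambda>l. flux (euler (\<kappa> n) (step (\<kappa> n)) l) r"]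
      unfolding approx_def tick_def X_def has_integral_Icc_iff_Ioo[symmetric] .
    moreover have "X n \<subseteq> {0<..<t}" using tick_le[OF t, of "\<kappa> n"] by (auto simp: X_def)
    ultimately show ?thesis unfolding f_def by (subst has_integral_restrict) auto
  qed
  have "(\<lambda>n. integral {0<..<t} (f n)) \<longlonglongrightarrow> integral {0<..<t} (\<lambda>s. flux (c s) r)"
  proof (rule dominated_convergence)
    show "f n integrable_on {0<..<t}" for n using I[of n] by blast
    show "(\<lambda>s. coeff r * bound\<^sup>2) integrable_on {0<..<t}"
      by (simp add: integrable_on_Icc_iff_Ioo[symmetric] integrable_const_ivl)
    show "norm (f n s) \<le> coeff r * bound\<^sup>2" if "s \<in> {0<..<t}" for n s
      using flux_le[OF r approx_nonneg approx_le] flux_nonneg[OF r approx_nonneg] coeff_nonneg[OF r]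
      by (auto simp: f_def)
    show "(\<lambda>n. f n s) \<longlonglongrightarrow> flux (c s) r" if s: "s \<in> {0<..<t}" for s
    proof (rule Lim_transform_eventually[OF flux_approx_tendsto])
      show "0 \<le> s" using s by simp
      have "eventually (\<lambda>n. step (\<kappa> n) < t - s) sequentially"
        using order_tendstoD(2)[OF step_\<kappa>_tendsto, of "t - s"] s by simp
      then show "eventually (\<lambda>n. flux (approx (\<kappa> n) s) r = f n s) sequentially"
      proof eventually_elim
        case (elim n)
        then have "s \<in> X n" using tick_gt[of t "\<kappa> n"] s unfolding X_def by simp
        then show ?case by (simp add: f_def)
      qed
    qed
  qed
  \<comment> \<open>Equality holds only once the truncation contains \<open>r\<close>; before that
    \<open>accum\<close> is 0.\<close>
  moreover have "eventually (\<lambda>n. integral {0<..<t} (f n) = accum (\<kappa> n) t r) sequentially"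
    using eventually_reactions_upto[of "{r}"] r
    by (auto elim!: eventually_mono simp: accum_def integral_unique[OF I])
  ultimately have "(\<lambda>n. accum (\<kappa> n) t r) \<longlonglongrightarrow> integral {0<..<t} (\<lambda>s. flux (c s) r)"
    by (rule Lim_transform_eventually)
  then show ?thesis by (simp add: integral_open_interval_real)
qed

text \<open>Tightness with respect to \<open>weight\<close> allows the limit to be taken under the
  infinite sum, as the stoichiometric coefficients are bounded by 4.\<close>

lemma flux_integral:
  assumes "0 \<le> t"
  shows "(\<lambda>r. integral {0..t} (\<lambda>s. flux (c s) r)) summable_on reactions"
    and "c t i = cin i + (\<Sum>\<^sub>\<infinity>r\<in>reactions. stoich i r * integral {0..t} (\<lambda>s. flux (c s) r))"
proof -
  have *: "(\<lambda>r. integral {0..t} (\<lambda>s. flux (c s) r)) summable_on reactions"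
     "(\<lambda>n. \<Sum>r\<in>reactions_upto (\<kappa> n). stoich i r * accum (\<kappa> n) t r)
        \<longlonglongrightarrow> (\<Sum>\<^sub>\<infinity>r\<in>reactions. stoich i r * integral {0..t} (\<lambda>s. flux (c s) r))"
    using tight_sum_tendsto[of "\<lambda>n. reactions_upto (\<kappa> n)" reactions "\<lambda>n. accum (\<kappa> n) t"
        "\<lambda>r. integral {0..t} (\<lambda>s. flux (c s) r)" weight "tail_bound t" "stoich i" 4]
      reactions_upto_subset accum_nonneg accum_tendsto assms weight_nonneg finite_weight_le
      accum_weight_le abs_stoich_le
    by (simp_all add: accum_def)
  show "(\<lambda>r. integral {0..t} (\<lambda>s. flux (c s) r)) summable_on reactions" by (fact *(1))
  have "(\<lambda>n. approx (\<kappa> n) t i) \<longlonglongrightarrow>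
      cin i + (\<Sum>\<^sub>\<infinity>r\<in>reactions. stoich i r * integral {0..t} (\<lambda>s. flux (c s) r))"
    unfolding approx_eq by (intro tendsto_intros *(2))
  then show "c t i = cin i + (\<Sum>\<^sub>\<infinity>r\<in>reactions. stoich i r * integral {0..t} (\<lambda>s. flux (c s) r))"
    using approx_tendsto[OF assms] LIMSEQ_unique by blast
qed

end

subsection \<open>The limit is a mild solution\<close>

lemma has_sum_to_nat:
  fixes z :: "'r::countable \<Rightarrow> real"
  shows "((\<lambda>m. if m \<in> to_nat ` I then z (from_nat m) else 0) has_sum x) UNIV \<longleftrightarrow> (z has_sum x) I"
proof -
  have "((\<lambda>m. if m \<in> to_nat ` I then z (from_nat m) else 0) has_sum x) UNIV
      \<longleftrightarrow> ((\<lambda>m. z (from_nat m)) has_sum x) (to_nat ` I)"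
    by (rule has_sum_cong_neutral) auto
  also have "\<dots> \<longleftrightarrow> (((\<lambda>m. z (from_nat m)) \<circ> to_nat) has_sum x) I"
    by (rule has_sum_reindex) (simp add: inj_on_def)
  also have "\<dots> \<longleftrightarrow> (z has_sum x) I" by (simp add: o_def)
  finally show ?thesis .
qed

text \<open>Converts sums over a countable index set into ordinary series padded with zeros, the
  form in which monotone convergence is applied.\<close>

lemma summable_to_nat:
  fixes z :: "'r::countable \<Rightarrow> real"
  assumes "\<And>r. r \<in> I \<Longrightarrow> 0 \<le> z r"
  shows "summable (\<lambda>m. if m \<in> to_nat ` I then z (from_nat m) else 0) \<longleftrightarrow> z summable_on I" (is ?A)
    and "z summable_on I \<Longrightarrow> (\<Sum>m. if m \<in> to_nat ` I then z (from_nat m) else 0) = infsum z I"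
proof -
  show ?A
    by (subst summable_on_UNIV_nonneg_real_iff[symmetric]) (auto simp: assms summable_on_def has_sum_to_nat)
  show "(\<Sum>m. if m \<in> to_nat ` I then z (from_nat m) else 0) = infsum z I" if "z summable_on I"
  proof -
    have "((\<lambda>m. if m \<in> to_nat ` I then z (from_nat m) else 0) has_sum infsum z I) UNIV"
      using that by (simp add: has_sum_to_nat)
    then show ?thesis by (rule sums_unique[OF has_sum_imp_sums, symmetric])
  qed
qed

text \<open>Monotone convergence: if the integrals have a finite sum, then the sum of the functions
  has a finite integral and is therefore finite almost everywhere.\<close>

lemma nonneg_series_integral:
  fixes f :: "'r::countable \<Rightarrow> 'a::euclidean_space \<Rightarrow> real"
  assumes int: "\<And>r. r \<in> I \<Longrightarrow> set_integrable lebesgue S (f r)"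
    and nonneg: "\<And>r s. r \<in> I \<Longrightarrow> s \<in> S \<Longrightarrow> 0 \<le> f r s"
    and sum: "(\<lambda>r. LINT s:S|lebesgue. f r s) summable_on I"
  shows "AE s\<in>S in lebesgue. (\<lambda>r. f r s) summable_on I"
    and "AE s\<in>S in lebesgue. F s = (\<Sum>\<^sub>\<infinity>r\<in>I. f r s) \<Longrightarrow> set_integrable lebesgue S F"
    and "AE s\<in>S in lebesgue. F s = (\<Sum>\<^sub>\<infinity>r\<in>I. f r s) \<Longrightarrow>
      (LINT s:S|lebesgue. F s) = (\<Sum>\<^sub>\<infinity>r\<in>I. LINT s:S|lebesgue. f r s)"
proof -
  define h where "h m s = (if m \<in> to_nat ` I then indicator S s *\<^sub>R f (from_nat m) s else 0)" for m s
  define Y where "Y r = (LINT s:S|lebesgue. f r s)" for r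
  have h_int: "integrable lebesgue (h m)" for m
    using int unfolding h_def[abs_def] set_integrable_def by (cases "m \<in> to_nat ` I") auto
  have h_LINT: "integral\<^sup>L lebesgue (h m) = (if m \<in> to_nat ` I then Y (from_nat m) else 0)" for m
    by (simp add: h_def[abs_def] Y_def set_lebesgue_integral_def)
  have h_nonneg: "0 \<le> h m s" for m s using nonneg by (auto simp: h_def indicator_def)
  have Y_nonneg: "0 \<le> Y r" if "r \<in> I" for r
    unfolding Y_def set_lebesgue_integral_def using nonneg[OF that]
    by (intro Bochner_Integration.integral_nonneg) (auto simp: indicator_def)
  have hY: "summable (\<lambda>m. integral\<^sup>L lebesgue (h m))"
    unfolding h_LINT using sum summable_to_nat(1)[of I Y, OF Y_nonneg] by (simp add: Y_def[abs_def])
  have "(\<integral>\<^sup>+s. (\<Sum>m. ennreal (h m s)) \<partial>lebesgue) = (\<Sum>m. \<integral>\<^sup>+s. ennreal (h m s) \<partial>lebesgue)"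
    using h_int by (intro nn_integral_suminf) (auto intro: borel_measurable_integrable)
  also have "\<dots> = (\<Sum>m. ennreal (integral\<^sup>L lebesgue (h m)))"
    using h_int h_nonneg by (intro suminf_cong nn_integral_eq_integral) auto
  also have "\<dots> \<noteq> \<infinity>"
    using hY h_nonneg by (simp add: suminf_ennreal2 Bochner_Integration.integral_nonneg)
  finally have fin: "(\<integral>\<^sup>+s. (\<Sum>m. ennreal (h m s)) \<partial>lebesgue) \<noteq> \<infinity>" .
  have "AE s in lebesgue. (\<Sum>m. ennreal (h m s)) \<noteq> \<infinity>"
    using h_int by (intro nn_integral_PInf_AE[OF _ fin]) (auto intro!: borel_measurable_integrable borel_measurable_suminf_order)
  then have h_sum: "AE s in lebesgue. summable (\<lambda>m. h m s)"
    by eventually_elim (auto intro: summable_suminf_not_top h_nonneg)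
  have h_in: "h m s = (if m \<in> to_nat ` I then f (from_nat m) s else 0)" if "s \<in> S" for m s
    using that by (simp add: h_def)
  show AE_sum: "AE s\<in>S in lebesgue. (\<lambda>r. f r s) summable_on I"
    using h_sum
  proof eventually_elim
    case (elim s)
    then show ?case using summable_to_nat(1)[of I "\<lambda>r. f r s"] nonneg by (auto simp: h_in)
  qed
  have h_norm: "AE s in lebesgue. summable (\<lambda>m. norm (h m s))" "summable (\<lambda>m. LINT s|lebesgue. norm (h m s))"
    using h_sum hY h_nonneg by simp_all
  note H = h_int h_norm
  assume F: "AE s\<in>S in lebesgue. F s = (\<Sum>\<^sub>\<infinity>r\<in>I. f r s)"
  have F_eq: "AE s in lebesgue. (\<Sum>m. h m s) = indicator S s *\<^sub>R F s"
    using AE_sum F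
  proof eventually_elim
    case (elim s)
    show ?case
    proof (cases "s \<in> S")
      case True
      then show ?thesis using elim summable_to_nat(2)[of I "\<lambda>r. f r s"] nonneg by (simp add: h_in)
    qed (simp add: h_def cong: if_cong)
  qed
  \<comment> \<open>\<open>F\<close> is not assumed measurable. Its integrability is inherited from
    the series, from which it differs only on a negligible set.\<close>
  have h_int_sum: "integrable lebesgue (\<lambda>s. \<Sum>m. h m s)" by (rule integrable_suminf[OF H])
  obtain N where N: "negligible N" "\<And>s. s \<notin> N \<Longrightarrow> (\<Sum>m. h m s) = indicator S s *\<^sub>R F s"
    using F_eq unfolding eventually_ae_filter_negligible by blast
  have "(\<lambda>s. \<Sum>m. h m s) absolutely_integrable_on UNIV"
    using h_int_sum by (simp add: set_integrable_def)
  then have "(\<lambda>s. indicator S s *\<^sub>R F s) absolutely_integrable_on UNIV"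
    by (rule absolutely_integrable_spike[OF _ N(1)]) (metis N(2) DiffD2)
  then have int_F': "integrable lebesgue (\<lambda>s. indicator S s *\<^sub>R F s)" by (simp add: set_integrable_def)
  then show "set_integrable lebesgue S F" by (simp add: set_integrable_def)
  have "(LINT s|lebesgue. (\<Sum>m. h m s)) = (LINT s:S|lebesgue. F s)"
    unfolding set_lebesgue_integral_def
    by (rule integral_cong_AE[OF borel_measurable_integrable[OF h_int_sum]
          borel_measurable_integrable[OF int_F'] F_eq])
  then have "(LINT s:S|lebesgue. F s) = (LINT s|lebesgue. (\<Sum>m. h m s))" by simp
  also have "\<dots> = (\<Sum>m. integral\<^sup>L lebesgue (h m))" by (rule integral_suminf[OF H])
  also have "\<dots> = infsum Y I"
    unfolding h_LINT using sum summable_to_nat(2)[of I Y, OF Y_nonneg] by (simp add: Y_def[abs_def])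
  finally show "(LINT s:S|lebesgue. F s) = (\<Sum>\<^sub>\<infinity>r\<in>I. LINT s:S|lebesgue. f r s)"
    by (simp add: Y_def[abs_def])
qed

section \<open>The four series as sums over classes of reactions\<close>

lemma infsum_iterated:
  fixes x :: "'r \<Rightarrow> real"
  assumes x: "x summable_on I" and inj: "inj_on (\<lambda>(k, j). \<phi> k j) (Sigma A B)"
    and image: "(\<lambda>(k, j). \<phi> k j) ` Sigma A B = J" and J: "J \<subseteq> I"
  shows "k \<in> A \<Longrightarrow> (\<lambda>j. x (\<phi> k j)) summable_on B k"
    and "(\<lambda>k. \<Sum>\<^sub>\<infinity>j\<in>B k. x (\<phi> k j)) summable_on A"
    and "(\<Sum>\<^sub>\<infinity>k\<in>A. \<Sum>\<^sub>\<infinity>j\<in>B k. x (\<phi> k j)) = infsum x J"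
proof -
  have "x summable_on (\<lambda>(k, j). \<phi> k j) ` Sigma A B"
    using summable_on_subset_banach[OF x J] image by simp
  then have S: "(\<lambda>(k, j). x (\<phi> k j)) summable_on Sigma A B"
    unfolding summable_on_reindex[OF inj] by (simp add: o_def case_prod_unfold)
  show "(\<lambda>j. x (\<phi> k j)) summable_on B k" if "k \<in> A" using summable_on_SigmaD1[OF S that] .
  show "(\<lambda>k. \<Sum>\<^sub>\<infinity>j\<in>B k. x (\<phi> k j)) summable_on A"
    using summable_on_Sigma_banach[OF S] .
  show "(\<Sum>\<^sub>\<infinity>k\<in>A. \<Sum>\<^sub>\<infinity>j\<in>B k. x (\<phi> k j)) = infsum x J"
    unfolding infsum_Sigma'_banach[OF S] image[symmetric] infsum_reindex[OF inj]
    by (simp add: o_def case_prod_unfold)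
qed

text \<open>The four classes, which may overlap, distinguish where size \<open>i\<close> occurs: as
  donor after the reaction, acceptor before, acceptor after, donor before. They index
  \<open>Q1\<close>, \<open>Q2\<close>, \<open>Q3\<close> and \<open>Q4\<close> in this
  order.\<close>

definition shrinking :: "nat \<Rightarrow> (nat \<times> nat \<times> nat) set" where
  "shrinking i = {(p, j, k). 1 \<le> k \<and> k \<le> p \<and> p - k = i}"
definition receiving :: "nat \<Rightarrow> (nat \<times> nat \<times> nat) set" where
  "receiving i = {(p, j, k). 1 \<le> k \<and> k \<le> p \<and> j = i}"
definition grown :: "nat \<Rightarrow> (nat \<times> nat \<times> nat) set" where
  "grown i = {(p, j, k). 1 \<le> k \<and> k \<le> p \<and> j + k = i}"
definition donating :: "nat \<Rightarrow> (nat \<times> nat \<times> nat) set" where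
  "donating i = {(p, j, k). 1 \<le> k \<and> k \<le> p \<and> p = i}"

lemma reaction_classes: "shrinking i \<subseteq> reactions" "receiving i \<subseteq> reactions"
    "grown i \<subseteq> reactions" "donating i \<subseteq> reactions"
  by (auto simp: reactions_def shrinking_def receiving_def grown_def donating_def)

text \<open>For \<open>i \<noteq> 0\<close> the coefficient \<open>stoich i\<close> is a signed sum
  of the indicators of the four classes.\<close>

lemma infsum_stoich:
  assumes y: "y summable_on reactions" and i: "i \<noteq> 0"
  shows "(\<Sum>\<^sub>\<infinity>r\<in>reactions. stoich i r * y r) =
    infsum y (shrinking i) - infsum y (receiving i) + infsum y (grown i) - infsum y (donating i)"
proof -
  have ind: "((\<lambda>r. of_bool (r \<in> J) * y r) has_sum infsum y J) reactions" if "J \<subseteq> reactions" for J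
  proof -
    have "(y has_sum infsum y J) J" using summable_on_subset_banach[OF y that] by simp
    then show ?thesis using that by (subst has_sum_cong_neutral[where T = J and g = y]) auto
  qed
  have "((\<lambda>r. of_bool (r \<in> shrinking i) * y r - of_bool (r \<in> receiving i) * y r
      + of_bool (r \<in> grown i) * y r - of_bool (r \<in> donating i) * y r) has_sum
    infsum y (shrinking i) - infsum y (receiving i) + infsum y (grown i) - infsum y (donating i)) reactions"
    unfolding diff_conv_add_uminus by (intro has_sum_add has_sum_uminusI ind reaction_classes)
  moreover have "stoich i r * y r = of_bool (r \<in> shrinking i) * y r - of_bool (r \<in> receiving i) * y r
      + of_bool (r \<in> grown i) * y r - of_bool (r \<in> donating i) * y r" if "r \<in> reactions" for r
    using that i by (cases r)
      (auto simp: reactions_def shrinking_def receiving_def grown_def donating_def)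
  ultimately have "((\<lambda>r. stoich i r * y r) has_sum
    infsum y (shrinking i) - infsum y (receiving i) + infsum y (grown i) - infsum y (donating i)) reactions"
    by (simp cong: has_sum_cong)
  then show ?thesis by (rule infsumI)
qed

context exchange
begin

text \<open>Each iterated series runs injectively through one class, so summability of the flux over
  all reactions yields convergence and permits any order of summation.\<close>

lemma series_reindexed:
  assumes u: "flux u summable_on reactions" and i: "i \<noteq> 0"
  shows "Q_convergent a i u" "Q1 a i u = infsum (flux u) (shrinking i)"
    "Q2 a i u = - infsum (flux u) (receiving i)" "Q3 a i u = infsum (flux u) (grown i)"
    "Q4 a i u = - infsum (flux u) (donating i)"
proof -
  note I1 = infsum_iterated[OF u, of "\<lambda>k j. (i + k, j, k)" "{1..}" "\<lambda>_. {0..}" "shrinking i"]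
  note I2 = infsum_iterated[OF u, of "\<lambda>k j. (j, i, k)" "{1..}" "\<lambda>k. {k..}" "receiving i"]
  note I3 = infsum_iterated[OF u, of "\<lambda>k j. (j, i - k, k)" "{1..i}" "\<lambda>k. {k..}" "grown i"]
  note I4 = infsum_iterated[OF u, of "\<lambda>k j. (i, j, k)" "{1..i}" "\<lambda>_. {0..}" "donating i"]
  have inj: "inj_on (\<lambda>(k, j). (i + k, j, k)) (Sigma {1..} (\<lambda>_. {0..}))"
    "inj_on (\<lambda>(k, j). (j, i, k)) (Sigma {1..} (\<lambda>k. {k..}))"
    "inj_on (\<lambda>(k, j). (j, i - k, k)) (Sigma {1..i} (\<lambda>k. {k..}))"
    "inj_on (\<lambda>(k, j). (i, j, k)) (Sigma {1..i} (\<lambda>_. {0..}))"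
    by (auto simp: inj_on_def)
  have "(p, j, k) \<in> (\<lambda>(k, j). (i + k, j, k)) ` Sigma {1..} (\<lambda>_. {0..})" if "(p, j, k) \<in> shrinking i" for p j k
    using that by (intro image_eqI[of _ _ "(k, j)"]) (auto simp: shrinking_def)
  then have im1: "(\<lambda>(k, j). (i + k, j, k)) ` Sigma {1..} (\<lambda>_. {0..}) = shrinking i"
    by (auto simp: shrinking_def)
  have "(p, j, k) \<in> (\<lambda>(k, j). (j, i, k)) ` Sigma {1..} (\<lambda>k. {k..})" if "(p, j, k) \<in> receiving i" for p j k
    using that by (intro image_eqI[of _ _ "(k, p)"]) (auto simp: receiving_def)
  then have im2: "(\<lambda>(k, j). (j, i, k)) ` Sigma {1..} (\<lambda>k. {k..}) = receiving i"
    by (auto simp: receiving_def)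
  have "(p, j, k) \<in> (\<lambda>(k, j). (j, i - k, k)) ` Sigma {1..i} (\<lambda>k. {k..})" if "(p, j, k) \<in> grown i" for p j k
    using that by (intro image_eqI[of _ _ "(k, p)"]) (auto simp: grown_def)
  then have im3: "(\<lambda>(k, j). (j, i - k, k)) ` Sigma {1..i} (\<lambda>k. {k..}) = grown i"
    by (auto simp: grown_def)
  have "(p, j, k) \<in> (\<lambda>(k, j). (i, j, k)) ` Sigma {1..i} (\<lambda>_. {0..})" if "(p, j, k) \<in> donating i" for p j k
    using that by (intro image_eqI[of _ _ "(k, j)"]) (auto simp: donating_def)
  then have im4: "(\<lambda>(k, j). (i, j, k)) ` Sigma {1..i} (\<lambda>_. {0..}) = donating i"
    by (auto simp: donating_def)
  note J1 = I1[OF inj(1) im1 reaction_classes(1), unfolded flux.simps]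
  note J2 = I2[OF inj(2) im2 reaction_classes(2), unfolded flux.simps]
  note J3 = I3[OF inj(3) im3 reaction_classes(3), unfolded flux.simps]
  note J4 = I4[OF inj(4) im4 reaction_classes(4), unfolded flux.simps]
  show "Q_convergent a i u"
    unfolding Q_convergent_def using J1(1,2) J2(1,2) J3(1) J4(1) by blast
  show "Q1 a i u = infsum (flux u) (shrinking i)" "Q2 a i u = - infsum (flux u) (receiving i)"
    using i J1(3) J2(3) by (simp_all add: Q1_def Q2_def)
  show "Q3 a i u = infsum (flux u) (grown i)" "Q4 a i u = - infsum (flux u) (donating i)"
    using i J3(3) J4(3) by (simp_all add: Q3_def Q4_def)
qed

end

section \<open>The time-integrated equation\<close>

context exchange_limit
begin

lemma flux_set_integrable:
  assumes "0 < t"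
  shows "set_integrable lebesgue {0<..<t} (\<lambda>s. flux (c s) r)"
    and "(LINT s:{0<..<t}|lebesgue. flux (c s) r) = integral {0..t} (\<lambda>s. flux (c s) r)"
proof -
  have "continuous_on {0..t} (\<lambda>s. flux (c s) r)"
    using continuous_flux by (rule continuous_on_subset) auto
  then have "set_integrable lebesgue {0..t} (\<lambda>s. flux (c s) r)"
    unfolding set_integrable_def
    by (subst integrable_restrict_space[symmetric]) (auto intro: continuous_imp_integrable_real)
  then show *: "set_integrable lebesgue {0<..<t} (\<lambda>s. flux (c s) r)"
    by (rule set_integrable_subset) auto
  show "(LINT s:{0<..<t}|lebesgue. flux (c s) r) = integral {0..t} (\<lambda>s. flux (c s) r)"
    using set_lebesgue_integral_eq_integral(2)[OF *] by (simp add: integral_open_interval_real)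
qed

text \<open>The time integrals of all fluxes are summable, so at almost every time the fluxes
  themselves are. At such times the four series are subfamilies of one summable family and may be
  integrated term by term.\<close>

lemma mild_solution_limit: "mild_solution a \<infinity> cin c"
  unfolding mild_solution_def
proof (intro conjI allI impI)
  show "c t \<in> X01_pos" if "0 \<le> t \<and> ereal t < \<infinity>" for t using c_X01_pos that by blast
  show "continuous_on {t. 0 \<le> t \<and> ereal t < \<infinity>} (\<lambda>t. c t i)" for i
    using continuous_c by (simp add: atLeast_def)
  fix i t assume "0 < t \<and> ereal t < \<infinity>"
  then have t: "0 < t" by simp
  define Y where "Y r = (LINT s:{0<..<t}|lebesgue. flux (c s) r)" for r
  have Y: "Y r = integral {0..t} (\<lambda>s. flux (c s) r)" for r
    using flux_set_integrable(2)[OF t] by (simp add: Y_def)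
  have Y_sum: "Y summable_on reactions"
    using flux_integral(1)[of t] t by (simp add: Y[abs_def])
  have nonneg: "0 \<le> flux (c s) r" if "r \<in> reactions" "s \<in> {0<..<t}" for r s
    using that by (intro flux_c_nonneg) auto
  have ae: "AE s\<in>{0<..<t} in lebesgue. flux (c s) summable_on reactions"
    using nonneg_series_integral(1)[OF flux_set_integrable(1)[OF t] nonneg] Y_sum by (simp add: Y_def[abs_def])
  have part: "set_integrable lebesgue {0<..<t} F \<and> (LINT s:{0<..<t}|lebesgue. F s) = infsum Y J"
    if "J \<subseteq> reactions" "AE s\<in>{0<..<t} in lebesgue. F s = infsum (flux (c s)) J" for F J
    using nonneg_series_integral(2,3)[where f = "\<lambda>r s. flux (c s) r" and I = J and S = "{0<..<t}" and F = F,
        OF flux_set_integrable(1)[OF t] nonneg]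
      summable_on_subset_banach[OF Y_sum that(1)] that by (auto simp: Y_def[abs_def])
  have c_t: "c t i = cin i + (\<Sum>\<^sub>\<infinity>r\<in>reactions. stoich i r * Y r)"
    using flux_integral(2)[of t i] t by (simp add: Y)
  have *: "(AE s\<in>{0<..<t} in lebesgue. Q_convergent a i (c s)) \<and>
      (\<forall>Q\<in>{Q1, Q2, Q3, Q4}. set_integrable lebesgue {0<..<t} (\<lambda>s. Q a i (c s))) \<and>
      (LINT s:{0<..<t}|lebesgue. Q1 a i (c s) + Q2 a i (c s) + Q3 a i (c s) + Q4 a i (c s))
        = (\<Sum>\<^sub>\<infinity>r\<in>reactions. stoich i r * Y r)"
  proof (cases "i = 0")
    case True
    have "stoich 0 r = 0" for r by (cases r) simp
    then show ?thesis using True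
      by (simp add: Q_convergent_def Q1_def Q2_def Q3_def Q4_def set_integrable_def set_lebesgue_integral_def)
  next
    case False
    note R = series_reindexed[OF _ False]
    have p1: "set_integrable lebesgue {0<..<t} (\<lambda>s. Q1 a i (c s)) \<and>
        (LINT s:{0<..<t}|lebesgue. Q1 a i (c s)) = infsum Y (shrinking i)"
      using ae by (intro part reaction_classes) (auto simp: R elim!: eventually_mono)
    \<comment> \<open>\<open>Q2\<close> and \<open>Q4\<close> are negated to fit
      \<open>part\<close>, which concerns sums of nonnegative fluxes.\<close>
    have p2: "set_integrable lebesgue {0<..<t} (\<lambda>s. - Q2 a i (c s)) \<and>
        (LINT s:{0<..<t}|lebesgue. - Q2 a i (c s)) = infsum Y (receiving i)"
      using ae by (intro part reaction_classes) (auto simp: R elim!: eventually_mono)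
    have p3: "set_integrable lebesgue {0<..<t} (\<lambda>s. Q3 a i (c s)) \<and>
        (LINT s:{0<..<t}|lebesgue. Q3 a i (c s)) = infsum Y (grown i)"
      using ae by (intro part reaction_classes) (auto simp: R elim!: eventually_mono)
    have p4: "set_integrable lebesgue {0<..<t} (\<lambda>s. - Q4 a i (c s)) \<and>
        (LINT s:{0<..<t}|lebesgue. - Q4 a i (c s)) = infsum Y (donating i)"
      using ae by (intro part reaction_classes) (auto simp: R elim!: eventually_mono)
    have int: "set_integrable lebesgue {0<..<t} (\<lambda>s. Q1 a i (c s))"
      "set_integrable lebesgue {0<..<t} (\<lambda>s. Q2 a i (c s))"
      "set_integrable lebesgue {0<..<t} (\<lambda>s. Q3 a i (c s))"
      "set_integrable lebesgue {0<..<t} (\<lambda>s. Q4 a i (c s))"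
      using p1 p2 p3 p4 by (simp_all add: set_integrable_def)
    have neg: "(LINT s:{0<..<t}|lebesgue. - F s) = - (LINT s:{0<..<t}|lebesgue. F s)" for F :: "real \<Rightarrow> real"
      by (simp add: set_lebesgue_integral_def)
    have "(LINT s:{0<..<t}|lebesgue. Q1 a i (c s) + Q2 a i (c s) + Q3 a i (c s) + Q4 a i (c s))
        = (LINT s:{0<..<t}|lebesgue. Q1 a i (c s)) + (LINT s:{0<..<t}|lebesgue. Q2 a i (c s))
          + (LINT s:{0<..<t}|lebesgue. Q3 a i (c s)) + (LINT s:{0<..<t}|lebesgue. Q4 a i (c s))"
      using int by (simp add: set_integral_add)
    also have "\<dots> = infsum Y (shrinking i) - infsum Y (receiving i) + infsum Y (grown i) - infsum Y (donating i)"
      using p1 p2 p3 p4 unfolding neg by simp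
    finally have "(LINT s:{0<..<t}|lebesgue. Q1 a i (c s) + Q2 a i (c s) + Q3 a i (c s) + Q4 a i (c s))
        = infsum Y (shrinking i) - infsum Y (receiving i) + infsum Y (grown i) - infsum Y (donating i)" .
    moreover have "AE s\<in>{0<..<t} in lebesgue. Q_convergent a i (c s)"
      using ae by (auto simp: R elim!: eventually_mono)
    ultimately show ?thesis using int infsum_stoich[OF Y_sum False] by simp
  qed
  show "AE s\<in>{0<..<t} in lebesgue. Q_convergent a i (c s)"
    "\<forall>Q\<in>{Q1, Q2, Q3, Q4}. set_integrable lebesgue {0<..<t} (\<lambda>s. Q a i (c s))"
    "c t i = cin i + (LINT s:{0<..<t}|lebesgue. Q1 a i (c s) + Q2 a i (c s) + Q3 a i (c s) + Q4 a i (c s))"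
    using * c_t by simp_all
qed

end

theorem theorem3p4:
  fixes a :: "nat \<Rightarrow> nat \<Rightarrow> nat \<Rightarrow> real"
    and q :: "nat \<Rightarrow> nat \<Rightarrow> real"
    and C QQ :: real
    and cin :: "nat \<Rightarrow> real"
  assumes "rate_coefficients a"
    and "cin \<in> X01_pos"
    and "C \<ge> 1" and "QQ \<ge> 1"
    and "\<And>i k. 1 \<le> k \<Longrightarrow> k \<le> i \<Longrightarrow> q i k \<ge> 0"
    and "\<And>i. i \<ge> 1 \<Longrightarrow> (\<Sum>k = 1..i. real k * real (i - k + 1) * q i k) \<le> QQ * real i"
    and "\<And>i j k. 1 \<le> k \<Longrightarrow> k \<le> i \<Longrightarrow> j \<ge> 1 \<Longrightarrow>
           a i j k \<le> C * real (i - k + 1) * real (j + k) * q i k"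
  shows "\<exists>c. mild_solution a \<infinity> cin c"
proof -
  interpret exchange a q C QQ cin by standard (fact assms)+
  \<comment> \<open>The weight is adapted to the mass distribution \<open>real i * cin i\<close>; as
    \<open>g i \<le> real i * d i\<close>, the initial moment of \<open>g\<close> is then
    finite.\<close>
  obtain d :: "nat \<Rightarrow> real" where d: "mono d" "\<And>l. 1 \<le> d l" "\<And>l. d (2 * l + 1) \<le> 2 * d l"
    "filterlim d at_top sequentially" "summable (\<lambda>i. d i * (real i * cin i))"
    using ex_slow_weight[of "\<lambda>i. real i * cin i"] summable_mass cin_nonneg by auto
  interpret weighted_exchange a q C QQ cin d by standard (fact d)+
  obtain \<kappa> c where \<kappa>: "strict_mono (\<kappa> :: nat \<Rightarrow> nat)"
    "\<And>t i. 0 \<le> t \<Longrightarrow> (\<lambda>n. approx (\<kappa> n) t i) \<longlonglongrightarrow> c t i"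
    using approx_subsequence by blast
  interpret exchange_limit a q C QQ cin d \<kappa> c by standard (fact \<kappa>)+
  show ?thesis using mild_solution_limit by blast
qed

end
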